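(* Let $K$ be an infinite field, $n\geq 2$, $S=K[x_1,\ldots,x_n]$. Let $I,J\subset S$ be two monomial ideals of Borel type. Then $$\operatorname{reg}(I\cdot J)\leq \operatorname{reg}(I)+\operatorname{reg}(J).$$
   Context: A monomial ideal $I\subset S$ is of Borel type if $(I:x_j^\infty)=(I:(x_1,\ldots,x_j)^\infty)$ for all $j=1,\ldots,n$. $\operatorname{reg}(M)=\max\{j-i:\beta_{ij}(M)\neq 0\}$ is the Castelnuovo-Mumford regularity of a finitely generated graded $S$-module $M$, with $\operatorname{reg}(0)=-\infty$. *)

theory Defs
  imports "HOL-Library.Poly_Mapping" "HOL-Library.Extended_Real" "HOL-Library.Cardinality"
begin

section \<open>Polynomials\<close>

text \<open>
  The polynomial ring S = K[x_1, ..., x_n] is the type of polynomial mappings from exponent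
  vectors to K, with n the cardinality of the finite type \<^typ>\<open>'n\<close> indexing the variables. A
  linear order on \<^typ>\<open>'n\<close> provides the order x_1, ..., x_n of the variables.
\<close>

type_synonym ('n, 'a) mpoly = "('n \<Rightarrow>\<^sub>0 nat) \<Rightarrow>\<^sub>0 'a"

definition monomial :: "('n \<Rightarrow>\<^sub>0 nat) \<Rightarrow> ('n, 'a::comm_ring_1) mpoly" where
  "monomial t = Poly_Mapping.single t 1"

definition Var :: "'n \<Rightarrow> ('n, 'a::comm_ring_1) mpoly" where
  "Var i = monomial (Poly_Mapping.single i 1)"

definition mon_degree :: "('n \<Rightarrow>\<^sub>0 nat) \<Rightarrow> nat" where
  "mon_degree t = (\<Sum>i\<in>Poly_Mapping.keys t. Poly_Mapping.lookup t i)"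

definition homog_comp :: "int \<Rightarrow> ('n, 'a::comm_ring_1) mpoly set" where
  "homog_comp d = {p. \<forall>t\<in>Poly_Mapping.keys p. int (mon_degree t) = d}"


section \<open>Ideals\<close>

definition ideal_gen :: "'r::comm_ring_1 set \<Rightarrow> 'r set" where
  "ideal_gen B = module.span (*) B"

definition ideal_prod :: "'r::comm_ring_1 set \<Rightarrow> 'r set \<Rightarrow> 'r set" where
  "ideal_prod I J = ideal_gen {f * g | f g. f \<in> I \<and> g \<in> J}"

primrec ideal_power :: "'r::comm_ring_1 set \<Rightarrow> nat \<Rightarrow> 'r set" where
  "ideal_power I 0 = UNIV"
| "ideal_power I (Suc k) = ideal_prod I (ideal_power I k)"

definition ideal_colon :: "'r::comm_ring_1 set \<Rightarrow> 'r set \<Rightarrow> 'r set" where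
  "ideal_colon I J = {f. \<forall>g\<in>J. f * g \<in> I}"

definition ideal_saturation :: "'r::comm_ring_1 set \<Rightarrow> 'r set \<Rightarrow> 'r set" where
  "ideal_saturation I J = (\<Union>k. ideal_colon I (ideal_power J k))"

definition monomial_ideal :: "('n, 'a::comm_ring_1) mpoly set \<Rightarrow> bool" where
  "monomial_ideal I \<longleftrightarrow> (\<exists>G. I = ideal_gen (monomial ` G))"

definition Borel_type :: "('n::linorder, 'a::comm_ring_1) mpoly set \<Rightarrow> bool" where
  "Borel_type I \<longleftrightarrow>
     (\<forall>j. ideal_saturation I (ideal_gen {Var j}) = ideal_saturation I (ideal_gen (Var ` {..j})))"


section \<open>Minimal graded free resolutions, Betti numbers, regularity\<close>

text \<open>The free module of rank r; the k-th coordinate belongs to the k-th basis vector.\<close>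

definition free_mod :: "nat \<Rightarrow> (nat \<Rightarrow> 'r::comm_ring_1) set" where
  "free_mod r = {v. \<forall>k\<ge>r. v k = 0}"

text \<open>The linear map on the free module of rank r that sends the k-th basis vector to w k.\<close>

definition free_map :: "nat \<Rightarrow> (nat \<Rightarrow> nat \<Rightarrow> 'r::comm_ring_1) \<Rightarrow> (nat \<Rightarrow> 'r) \<Rightarrow> (nat \<Rightarrow> 'r)" where
  "free_map r w v = (\<lambda>l. \<Sum>k<r. v k * w k l)"

definition augmentation ::
    "('r \<Rightarrow> 'm \<Rightarrow> 'm::comm_monoid_add) \<Rightarrow> nat \<Rightarrow> (nat \<Rightarrow> 'm) \<Rightarrow> (nat \<Rightarrow> 'r) \<Rightarrow> 'm" where
  "augmentation smul r g v = (\<Sum>k<r. smul (v k) (g k))"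

text \<open>
  A graded S-module is given by its scalar multiplication \<open>smul\<close>, its carrier \<open>M\<close>, and sets
  \<open>H j\<close> such that the component of degree j is \<open>M \<inter> H j\<close>.

  The resolution is F_0 <- F_1 <- ..., where F_i is the direct sum of the S(- d i k) for
  \<open>k < r i\<close>, so that \<open>d i k\<close> is the degree of the k-th basis vector of F_i. This vector is sent
  to \<open>g k\<close> in \<open>M\<close> if i = 0, and to \<open>w (i - 1) k\<close> in F_(i - 1) otherwise. These images are
  homogeneous of degree \<open>d i k\<close>. The last clause says that F_(i + 1) is mapped into m F_i, with
  m the ideal generated by the variables.
\<close>

definition minimal_graded_free_resolution ::
    "(('n, 'a::field) mpoly \<Rightarrow> 'm \<Rightarrow> 'm::ab_group_add) \<Rightarrow> 'm set \<Rightarrow> (int \<Rightarrow> 'm set) \<Rightarrow>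
     (nat \<Rightarrow> nat) \<Rightarrow> (nat \<Rightarrow> nat \<Rightarrow> int) \<Rightarrow> (nat \<Rightarrow> 'm) \<Rightarrow>
     (nat \<Rightarrow> nat \<Rightarrow> nat \<Rightarrow> ('n, 'a) mpoly) \<Rightarrow> bool" where
  "minimal_graded_free_resolution smul M H r d g w \<longleftrightarrow>
     (\<forall>k<r 0. g k \<in> M \<inter> H (d 0 k)) \<and>
     (\<forall>i. \<forall>k<r (Suc i). w i k \<in> free_mod (r i) \<and>
        (\<forall>l<r i. w i k l \<in> homog_comp (d (Suc i) k - d i l))) \<and>
     augmentation smul (r 0) g ` free_mod (r 0) = M \<and>
     {v \<in> free_mod (r 0). augmentation smul (r 0) g v = 0} =
       free_map (r 1) (w 0) ` free_mod (r 1) \<and>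
     (\<forall>i. {v \<in> free_mod (r (Suc i)). free_map (r (Suc i)) (w i) v = (\<lambda>_. 0)} =
       free_map (r (Suc (Suc i))) (w (Suc i)) ` free_mod (r (Suc (Suc i)))) \<and>
     (\<forall>i. \<forall>k<r (Suc i). \<forall>l<r i. w i k l \<in> ideal_gen (range Var))"

text \<open>
  Finitely generated graded modules have a minimal graded free resolution with finite ranks,
  which is unique up to isomorphism, so the number below does not depend on the choice.
\<close>

definition betti ::
    "(('n, 'a::field) mpoly \<Rightarrow> 'm \<Rightarrow> 'm::ab_group_add) \<Rightarrow> 'm set \<Rightarrow> (int \<Rightarrow> 'm set) \<Rightarrow>
     nat \<Rightarrow> int \<Rightarrow> nat" where
  "betti smul M H i j =
     (SOME b. \<exists>r d g w. minimal_graded_free_resolution smul M H r d g w \<and>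
        b = card {k. k < r i \<and> d i k = j})"

text \<open>
  For a finitely generated module only finitely many Betti numbers are nonzero, so the supremum
  is a maximum, except that it is \<open>-\<infinity>\<close> for the zero module.
\<close>

definition reg ::
    "(('n, 'a::field) mpoly \<Rightarrow> 'm \<Rightarrow> 'm::ab_group_add) \<Rightarrow> 'm set \<Rightarrow> (int \<Rightarrow> 'm set) \<Rightarrow> ereal"
  where
  "reg smul M H = Sup {ereal (of_int (j - int i)) | i j. betti smul M H i j \<noteq> 0}"

definition reg_ideal :: "('n, 'a::field) mpoly set \<Rightarrow> ereal" where
  "reg_ideal I = reg (*) I homog_comp"

end

theory Submission imports Defs "HOL-Library.Function_Algebras" begin

text \<open>
  Let \<open>I\<close> be a monomial ideal with set of exponent vectors \<open>E\<close>, and let \<open>\<rho> \<ge> 0\<close>. The proof compares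
  the regularity of \<open>I\<close> with the following condition, called \<^emph>\<open>last reducibility\<close>: every monomial
  of \<open>I\<close> of degree above \<open>\<rho>\<close> stays in \<open>I\<close> when it is divided by its last variable. (For an integer
  \<open>\<rho>\<close> it says that \<open>I\<close> is generated in degrees at most \<open>\<rho>\<close> and that the truncation of \<open>I\<close> to
  degrees at least \<open>\<rho>\<close> is a stable ideal.)

  Three facts give the theorem. Last reducibility for \<open>\<rho>\<close> implies that the regularity is at most
  \<open>\<rho>\<close> (\<open>reg_mon_ideal_le\<close>). A nonzero ideal of Borel type satisfies last reducibility for its own
  regularity (\<open>reg_Borel_type\<close>). If \<open>I\<close> and \<open>J\<close> satisfy it for \<open>e\<close> and \<open>f\<close>, then the product of
  \<open>I\<close> and \<open>J\<close> satisfies it for \<open>e + f\<close> (\<open>last_reducible_sum_set\<close>): in a product of two monomials,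
  variables can be moved from one factor to the other until the factor that contains the last
  variable has large degree.

  The first two facts rest on reading Betti numbers off Koszul homology with coefficients in the
  ideal, in homological degree i and internal degree j (\<open>betti_nonzero_iff\<close>). Along a minimal
  resolution, Koszul homology of an ideal in homological degree i is shifted step by step to
  Koszul homology of the i-th syzygy module in homological degree 0, and the latter is nonzero
  exactly in the degrees of the minimal generators. That minimal resolutions of finite rank exist
  is part of the claim; it also follows from Koszul homology, since vanishing in all large
  internal degrees bounds the degrees of the generators of each syzygy module.

  The Koszul homology of a monomial ideal is controlled by a cone construction whose apex is the
  last variable of the multidegree. Under last reducibility the cone over a cycle of internal
  degree j and homological degree i stays in the ideal if \<open>j - i > \<rho>\<close>, so the homology vanishes
  (\<open>kvanish_mon_ideal\<close>). Conversely, if last reducibility fails at a monomial of degree m, then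
  the Borel type condition yields a monomial z of degree at least \<open>m - 1\<close> in the variables up to
  some i, outside the ideal, whose products with the variables up to i all lie in the ideal.
  The boundary of z times the exterior product of these variables is a cycle that is not a boundary
  (\<open>not_kvanish_mon_ideal\<close>), and it forces the regularity to be at least m.
\<close>

section \<open>Polynomials and their homogeneous components\<close>

lemma poly_mapping_additive_induct [case_names zero add single]:
  fixes p :: "'b \<Rightarrow>\<^sub>0 'c::comm_monoid_add"
  assumes "P 0" "\<And>p q. P p \<Longrightarrow> P q \<Longrightarrow> P (p + q)" "\<And>t a. P (Poly_Mapping.single t a)"
  shows "P p"
proof (induction p rule: update_induct)
  case const
  show ?case by (fact assms(1))
next
  case (update f a b)
  have "Poly_Mapping.update a b f = f + Poly_Mapping.single a b"
    using update(1)
    by (intro poly_mapping_eqI) (auto simp: lookup_update lookup_add lookup_single in_keys_iff when_def)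
  then show ?case using update(3) assms(2,3) by simp
qed

lemma lookup_single_times_add:
  fixes p :: "('n, 'a::comm_ring_1) mpoly"
  shows "Poly_Mapping.lookup (Poly_Mapping.single s a * p) (s + t) = a * Poly_Mapping.lookup p t"
  by (induction p rule: poly_mapping_additive_induct)
     (auto simp: distrib_left lookup_add mult_single lookup_single when_def)

lemma lookup_single_times_eq_0:
  fixes p :: "('n, 'a::comm_ring_1) mpoly"
  assumes "\<nexists>u. t = s + u"
  shows "Poly_Mapping.lookup (Poly_Mapping.single s a * p) t = 0"
  using assms
  by (induction p rule: poly_mapping_additive_induct)
     (auto simp: distrib_left lookup_add mult_single lookup_single when_def)

lemma exponent_split:
  fixes t :: "'n \<Rightarrow>\<^sub>0 nat"
  assumes "0 < Poly_Mapping.lookup t l"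
  shows "t = Poly_Mapping.single l 1 + (t - Poly_Mapping.single l 1)"
  using assms
  by (intro poly_mapping_eqI) (auto simp: lookup_add lookup_minus lookup_single when_def)

lemma lookup_Var_times:
  fixes p :: "('n, 'a::comm_ring_1) mpoly"
  shows "Poly_Mapping.lookup (Var l * p) t =
    (if 0 < Poly_Mapping.lookup t l then Poly_Mapping.lookup p (t - Poly_Mapping.single l 1) else 0)"
proof (cases "0 < Poly_Mapping.lookup t l")
  case True
  then show ?thesis
    using lookup_single_times_add[of "Poly_Mapping.single l 1" 1 p "t - Poly_Mapping.single l 1"]
      exponent_split[OF True] by (simp add: Var_def monomial_def)
next
  case False
  then have "\<nexists>u. t = Poly_Mapping.single l 1 + u"
    by (auto simp: lookup_add)
  then show ?thesis
    using False lookup_single_times_eq_0 by (simp add: Var_def monomial_def)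
qed

lemma mon_degree_UNIV: "mon_degree (t :: 'n::finite \<Rightarrow>\<^sub>0 nat) = (\<Sum>i\<in>UNIV. Poly_Mapping.lookup t i)"
  unfolding mon_degree_def by (rule sum.mono_neutral_left) (auto simp: in_keys_iff)

lemma mon_degree_0 [simp]: "mon_degree 0 = 0"
  by (simp add: mon_degree_def)

lemma mon_degree_single [simp]: "mon_degree (Poly_Mapping.single i m) = m"
  by (simp add: mon_degree_def)

lemma mon_degree_add: "mon_degree (s + t) = mon_degree s + mon_degree (t :: 'n::finite \<Rightarrow>\<^sub>0 nat)"
  by (simp add: mon_degree_UNIV lookup_add sum.distrib)

lemma mon_degree_eq_0_iff: "mon_degree t = 0 \<longleftrightarrow> t = (0 :: 'n::finite \<Rightarrow>\<^sub>0 nat)"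
  by (auto simp: mon_degree_UNIV poly_mapping_eq_iff fun_eq_iff)

lemma homog_comp_iff:
  "p \<in> homog_comp d \<longleftrightarrow> (\<forall>t. Poly_Mapping.lookup p t \<noteq> 0 \<longrightarrow> int (mon_degree t) = d)"
  by (auto simp: homog_comp_def in_keys_iff)

lemma homog_comp_0 [simp]: "0 \<in> homog_comp d"
  by (simp add: homog_comp_iff)

lemma homog_comp_add: "p \<in> homog_comp d \<Longrightarrow> q \<in> homog_comp d \<Longrightarrow> p + q \<in> homog_comp d"
  unfolding homog_comp_iff lookup_add by (metis add.right_neutral)

lemma homog_comp_diff: "p \<in> homog_comp d \<Longrightarrow> q \<in> homog_comp d \<Longrightarrow> p - q \<in> homog_comp d"
  unfolding homog_comp_iff lookup_minus by (metis diff_self)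

lemma homog_comp_times:
  fixes p q :: "('n::finite, 'a::comm_ring_1) mpoly"
  assumes "p \<in> homog_comp a" "q \<in> homog_comp b"
  shows "p * q \<in> homog_comp (a + b)"
  using assms keys_mult[of p q] by (fastforce simp: homog_comp_def mon_degree_add)

text \<open>The homogeneous component of degree \<open>d\<close> of a polynomial.\<close>

definition hcomp :: "int \<Rightarrow> ('n, 'a::comm_ring_1) mpoly \<Rightarrow> ('n, 'a) mpoly" where
  "hcomp d p = Abs_poly_mapping (\<lambda>t. Poly_Mapping.lookup p t when int (mon_degree t) = d)"

lemma lookup_hcomp:
  "Poly_Mapping.lookup (hcomp d p) t = (Poly_Mapping.lookup p t when int (mon_degree t) = d)"
  unfolding hcomp_def
  by (subst lookup_Abs_poly_mapping)
     (auto intro: finite_subset[OF _ finite_lookup[of p]])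

lemma hcomp_in_homog_comp: "hcomp d p \<in> homog_comp d"
  by (auto simp: homog_comp_iff lookup_hcomp when_def)

lemma hcomp_0 [simp]: "hcomp d 0 = 0"
  by (intro poly_mapping_eqI) (simp add: lookup_hcomp)

lemma hcomp_add: "hcomp d (p + q) = hcomp d p + hcomp d q"
  by (intro poly_mapping_eqI) (simp add: lookup_hcomp lookup_add when_def)

lemma hcomp_sum: "hcomp d (sum f A) = (\<Sum>x\<in>A. hcomp d (f x))"
  by (induction A rule: infinite_finite_induct) (auto simp: hcomp_add)

lemma hcomp_homog: "p \<in> homog_comp e \<Longrightarrow> hcomp d p = (if d = e then p else 0)"
  by (intro poly_mapping_eqI) (auto simp: lookup_hcomp when_def homog_comp_iff)

lemma hcomp_times:
  fixes p q :: "('n::finite, 'a::comm_ring_1) mpoly"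
  assumes q: "q \<in> homog_comp b"
  shows "hcomp d (p * q) = hcomp (d - b) p * q"
proof (induction p rule: poly_mapping_additive_induct)
  case (single t a)
  have h: "Poly_Mapping.single t a \<in> homog_comp (int (mon_degree t))"
    by (auto simp: homog_comp_def)
  show ?case
    unfolding hcomp_homog[OF homog_comp_times[OF h q]] hcomp_homog[OF h] by auto
qed (auto simp: algebra_simps hcomp_add)

lemma sum_hcomp:
  assumes "finite D" "\<And>t. t \<in> Poly_Mapping.keys p \<Longrightarrow> int (mon_degree t) \<in> D"
  shows "(\<Sum>d\<in>D. hcomp d p) = p"
proof (rule poly_mapping_eqI)
  fix t
  have "(\<Sum>d\<in>D. Poly_Mapping.lookup p t when int (mon_degree t) = d) = Poly_Mapping.lookup p t"
    using assms by (cases "t \<in> Poly_Mapping.keys p") (auto simp: when_def sum.delta in_keys_iff)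
  then show "Poly_Mapping.lookup (\<Sum>d\<in>D. hcomp d p) t = Poly_Mapping.lookup p t"
    by (simp add: lookup_sum lookup_hcomp)
qed

interpretation imod: module "(*) :: 'r::comm_ring_1 \<Rightarrow> 'r \<Rightarrow> 'r"
  by unfold_locales (auto simp: algebra_simps)

\<comment> \<open>As a rewrite rule for multiplication, this loops with associativity.\<close>
declare imod.scale_scale [simp del]

lemma ideal_gen_eq_span: "ideal_gen B = imod.span B"
  by (simp add: ideal_gen_def)

text \<open>The ideal generated by the variables consists of the polynomials without constant term.\<close>

lemma maximal_ideal_eq:
  "ideal_gen (range Var) = {p :: ('n, 'a::comm_ring_1) mpoly. Poly_Mapping.lookup p 0 = 0}"
proof
  have "imod.subspace {p :: ('n, 'a) mpoly. Poly_Mapping.lookup p 0 = 0}"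
    unfolding imod.subspace_def
  proof (intro conjI ballI allI)
    fix c p :: "('n, 'a) mpoly"
    assume "p \<in> {p. Poly_Mapping.lookup p 0 = 0}"
    then have p0: "0 \<notin> Poly_Mapping.keys p"
      by (simp add: in_keys_iff)
    have "b = 0" if "a + b = 0" for a b :: "'n \<Rightarrow>\<^sub>0 nat"
    proof (rule poly_mapping_eqI)
      fix k
      have "Poly_Mapping.lookup (a + b) k = 0" unfolding that by simp
      then show "Poly_Mapping.lookup b k = Poly_Mapping.lookup 0 k" by (simp add: lookup_add)
    qed
    then have "0 \<notin> Poly_Mapping.keys (c * p)"
      using keys_mult[of c p] p0 by fastforce
    then show "c * p \<in> {p. Poly_Mapping.lookup p 0 = 0}"
      by (simp add: in_keys_iff)
  qed (auto simp: lookup_add)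
  moreover have "range Var \<subseteq> {p :: ('n, 'a) mpoly. Poly_Mapping.lookup p 0 = 0}"
  proof clarify
    fix l :: 'n
    have "Poly_Mapping.lookup (Poly_Mapping.single l (1::nat)) l \<noteq> Poly_Mapping.lookup 0 l" by simp
    then have "Poly_Mapping.single l (1::nat) \<noteq> 0" by metis
    then show "Poly_Mapping.lookup (Var l :: ('n, 'a) mpoly) 0 = 0"
      by (simp add: Var_def monomial_def lookup_single when_def)
  qed
  ultimately show "ideal_gen (range Var) \<subseteq> {p :: ('n, 'a) mpoly. Poly_Mapping.lookup p 0 = 0}"
    unfolding ideal_gen_eq_span by (rule imod.span_minimal[rotated])
next
  have *: "p - Poly_Mapping.single 0 (Poly_Mapping.lookup p 0) \<in> ideal_gen (range Var)" for p :: "('n, 'a) mpoly"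
  proof (induction p rule: poly_mapping_additive_induct)
    case zero
    show ?case by (simp add: ideal_gen_eq_span imod.span_zero)
  next
    case (add p q)
    then show ?case
      using imod.span_add[OF add[unfolded ideal_gen_eq_span]]
      by (simp add: ideal_gen_eq_span lookup_add single_add algebra_simps)
  next
    case (single t a)
    show ?case
    proof (cases "t = 0")
      case True
      then show ?thesis by (simp add: ideal_gen_eq_span imod.span_zero)
    next
      case False
      then obtain l where l: "0 < Poly_Mapping.lookup t l"
        by (auto simp: poly_mapping_eq_iff fun_eq_iff)
      have "Poly_Mapping.single t a = Poly_Mapping.single (t - Poly_Mapping.single l 1) a * Var l"
        using exponent_split[OF l] by (simp add: Var_def monomial_def mult_single add.commute)
      then have "Poly_Mapping.single t a \<in> ideal_gen (range Var)"
        by (simp only: ideal_gen_eq_span imod.span_scale imod.span_base rangeI)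
      moreover have "Poly_Mapping.lookup (Poly_Mapping.single t a) 0 = 0"
        using False by (simp add: lookup_single when_def)
      ultimately show ?thesis by simp
    qed
  qed
  show "{p :: ('n, 'a) mpoly. Poly_Mapping.lookup p 0 = 0} \<subseteq> ideal_gen (range Var)"
    proof
    fix p :: "('n, 'a) mpoly"
    assume "p \<in> {p. Poly_Mapping.lookup p 0 = 0}"
    then show "p \<in> ideal_gen (range Var)" using *[of p] by simp
  qed
qed

lemma homog_comp_lookup_0:
  assumes "p \<in> homog_comp d" "d \<noteq> 0"
  shows "Poly_Mapping.lookup p 0 = 0"
  using assms unfolding homog_comp_iff by (metis mon_degree_0 of_nat_0)

section \<open>The Koszul complex\<close>

text \<open>
  Elements of free modules are functions from the natural numbers to the ring, with coordinatewise
  addition and the following scalar multiplication.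
\<close>

definition vscale :: "'r::comm_ring_1 \<Rightarrow> (nat \<Rightarrow> 'r) \<Rightarrow> nat \<Rightarrow> 'r" where
  "vscale p v = (\<lambda>k. p * v k)"

interpretation vmod: module "vscale :: 'r::comm_ring_1 \<Rightarrow> (nat \<Rightarrow> 'r) \<Rightarrow> nat \<Rightarrow> 'r"
  by unfold_locales (auto simp: vscale_def fun_eq_iff distrib_left distrib_right mult.assoc)

lemma vscale_apply: "vscale p v k = p * v k"
  by (simp add: vscale_def)

text \<open>
  The differential of the Koszul complex of the variables. A chain assigns to each set \<open>T\<close> of
  variables the coefficient, a vector of polynomials, of the exterior product of \<open>T\<close>. The k-th
  coordinate of the boundary at \<open>T\<close> collects the coefficients at all sets \<open>insert l T\<close>, with the
  sign given by the position of l in this set. The differential does not restrict \<open>c\<close> to one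
  homological degree.
\<close>

definition kosz ::
    "('n::{finite,linorder} set \<Rightarrow> nat \<Rightarrow> ('n, 'a::comm_ring_1) mpoly) \<Rightarrow>
     'n set \<Rightarrow> nat \<Rightarrow> ('n, 'a) mpoly" where
  "kosz c T k = (\<Sum>l\<in>-T. (-1) ^ card {x\<in>T. x < l} * (Var l * c (insert l T) k))"

lemma lookup_minus_one_power_times:
  fixes p :: "('n, 'a::comm_ring_1) mpoly"
  shows "Poly_Mapping.lookup ((-1) ^ m * p) t = (-1) ^ m * Poly_Mapping.lookup p t"
  by (cases "even m") simp_all

lemma lookup_kosz:
  "Poly_Mapping.lookup (kosz c T k) t =
    (\<Sum>l\<in>-T. (-1) ^ card {x\<in>T. x < l} *
      (if 0 < Poly_Mapping.lookup t l
       then Poly_Mapping.lookup (c (insert l T) k) (t - Poly_Mapping.single l 1) else 0))"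
  unfolding kosz_def lookup_sum lookup_minus_one_power_times lookup_Var_times ..

lemma kosz_diff: "kosz (\<lambda>T. b T - c T) = kosz b - kosz c"
proof (intro ext)
  fix T k
  show "kosz (\<lambda>T. b T - c T) T k = (kosz b - kosz c) T k"
    unfolding kosz_def minus_apply right_diff_distrib sum_subtractf ..
qed

lemma sign_insert:
  fixes l l' :: "'n::{finite,linorder}"
  assumes "l' \<notin> T"
  shows "(-1 :: 'b::comm_ring_1) ^ card {x\<in>insert l' T. x < l} =
    (if l' < l then -1 else 1) * (-1) ^ card {x\<in>T. x < l}"
proof (cases "l' < l")
  case True
  then have "{x\<in>insert l' T. x < l} = insert l' {x\<in>T. x < l}" by auto
  then show ?thesis using assms True by simp
next
  case False
  then have "{x\<in>insert l' T. x < l} = {x\<in>T. x < l}" by auto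
  then show ?thesis using False by simp
qed

lemma sign_insert_swap:
  fixes l l' :: "'n::{finite,linorder}"
  assumes "l \<notin> T" "l' \<notin> T" "l \<noteq> l'"
  shows "(-1 :: 'b::comm_ring_1) ^ card {x\<in>T. x < l} * (-1) ^ card {x\<in>insert l T. x < l'} =
    - ((-1) ^ card {x\<in>T. x < l'} * (-1) ^ card {x\<in>insert l' T. x < l})"
proof (cases "l < l'")
  case True
  then have "\<not> l' < l" by simp
  then show ?thesis
    unfolding sign_insert[OF assms(1)] sign_insert[OF assms(2)] using True by (simp add: mult.commute)
next
  case False
  then have "l' < l" using assms(3) by simp
  then show ?thesis
    unfolding sign_insert[OF assms(1)] sign_insert[OF assms(2)] using False by (simp add: mult.commute)
qed

lemma minus_one_power_square: "(-1 :: 'b::comm_ring_1) ^ m * ((-1) ^ m * a) = a"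
  by (cases "even m") simp_all

text \<open>The hypothesis makes the terms cancel in pairs, so the characteristic may be 2.\<close>

lemma sum_antisymmetric_eq_0:
  fixes f :: "'b \<Rightarrow> 'b \<Rightarrow> 'c::ab_group_add"
  assumes "finite A" "\<And>l l'. l \<in> A \<Longrightarrow> l' \<in> A \<Longrightarrow> l \<noteq> l' \<Longrightarrow> f l l' = - f l' l"
  shows "(\<Sum>l\<in>A. \<Sum>l'\<in>A - {l}. f l l') = 0"
  using assms
proof (induction A rule: finite_induct)
  case (insert a A)
  have anti: "f l l' = - f l' l" if "l \<in> insert a A" "l' \<in> insert a A" "l \<noteq> l'" for l l'
    using insert.prems that by blast
  have "(\<Sum>l'\<in>insert a A - {l}. f l l') = f l a + (\<Sum>l'\<in>A - {l}. f l l')" if "l \<in> A" for l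
  proof -
    have "insert a A - {l} = insert a (A - {l})" using insert.hyps that by auto
    then show ?thesis using insert.hyps by simp
  qed
  then have "(\<Sum>l\<in>A. \<Sum>l'\<in>insert a A - {l}. f l l') = (\<Sum>l\<in>A. f l a) + (\<Sum>l\<in>A. \<Sum>l'\<in>A - {l}. f l l')"
    by (simp add: sum.distrib)
  also have "(\<Sum>l\<in>A. \<Sum>l'\<in>A - {l}. f l l') = 0"
    by (rule insert.IH, rule anti) auto
  also have "(\<Sum>l\<in>A. f l a) = (\<Sum>l\<in>A. - f a l)"
    using insert.hyps by (intro sum.cong refl anti) auto
  finally show ?case
    using insert.hyps by (simp add: sum_negf)
qed simp

lemma kosz_kosz:
  fixes c :: "'n::{finite,linorder} set \<Rightarrow> nat \<Rightarrow> ('n, 'a::comm_ring_1) mpoly"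
  shows "kosz (kosz c) = 0"
proof (intro ext)
  fix T :: "'n set" and k
  define f where "f l l' = (-1) ^ card {x\<in>T. x < l} * (Var l * ((-1) ^ card {x\<in>insert l T. x < l'} *
    (Var l' * c (insert l' (insert l T)) k)))" for l l'
  have eq: "f l l' = ((-1) ^ card {x\<in>T. x < l} * (-1) ^ card {x\<in>insert l T. x < l'}) *
    (Var l * Var l' * c (insert l' (insert l T)) k)" for l l'
    unfolding f_def by (simp only: mult_ac)
  have "kosz (kosz c) T k = (\<Sum>l\<in>-T. \<Sum>l'\<in>-T - {l}. f l l')"
    unfolding kosz_def f_def sum_distrib_left by (intro sum.cong refl) auto
  also have "\<dots> = 0"
  proof (rule sum_antisymmetric_eq_0)
    fix l l' assume "l \<in> - T" "l' \<in> - T" "l \<noteq> l'"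
    then show "f l l' = - f l' l"
      unfolding eq insert_commute[of l' l] mult.commute[of "Var l'" "Var l"]
      by (subst sign_insert_swap) simp_all
  qed simp
  finally show "kosz (kosz c) T k = 0 T k" by simp
qed

text \<open>
  The cone construction. The multidegree of the monomial t at the basis vector of T is the
  sum of t and the indicator function of T; its support is \<open>keys t \<union> T\<close>, and the apex of the cone is the
  largest variable in this support.
\<close>

definition apex :: "'n::linorder set \<Rightarrow> ('n \<Rightarrow>\<^sub>0 nat) \<Rightarrow> 'n" where
  "apex T t = Max (Poly_Mapping.keys t \<union> T)"

definition kcone ::
    "('n::{finite,linorder} set \<Rightarrow> nat \<Rightarrow> ('n, 'a::comm_ring_1) mpoly) \<Rightarrow>
     'n set \<Rightarrow> nat \<Rightarrow> ('n, 'a) mpoly" where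
  "kcone c T k = Abs_poly_mapping (\<lambda>t. if apex T t \<in> T
     then (-1) ^ card {x\<in>T - {apex T t}. x < apex T t} *
       Poly_Mapping.lookup (c (T - {apex T t}) k) (t + Poly_Mapping.single (apex T t) 1)
     else 0)"

lemma lookup_kcone:
  "Poly_Mapping.lookup (kcone c T k) t = (if apex T t \<in> T
     then (-1) ^ card {x\<in>T - {apex T t}. x < apex T t} *
       Poly_Mapping.lookup (c (T - {apex T t}) k) (t + Poly_Mapping.single (apex T t) 1)
     else 0)"
proof -
  have "finite (\<Union>i. (\<lambda>t. t + Poly_Mapping.single i 1) -` Poly_Mapping.keys (c (T - {i}) k))"
    by (intro finite_UN_I finite_vimageI) (auto simp: inj_def)
  then have "finite {t. (if apex T t \<in> T
     then (-1) ^ card {x\<in>T - {apex T t}. x < apex T t} *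
       Poly_Mapping.lookup (c (T - {apex T t}) k) (t + Poly_Mapping.single (apex T t) 1)
     else 0) \<noteq> 0}"
  proof (rule rev_finite_subset)
    show "{t. (if apex T t \<in> T
       then (-1) ^ card {x\<in>T - {apex T t}. x < apex T t} *
         Poly_Mapping.lookup (c (T - {apex T t}) k) (t + Poly_Mapping.single (apex T t) 1)
       else 0) \<noteq> 0} \<subseteq>
      (\<Union>i. (\<lambda>t. t + Poly_Mapping.single i 1) -` Poly_Mapping.keys (c (T - {i}) k))"
    proof clarify
      fix t
      assume "(if apex T t \<in> T
       then (-1) ^ card {x\<in>T - {apex T t}. x < apex T t} *
         Poly_Mapping.lookup (c (T - {apex T t}) k) (t + Poly_Mapping.single (apex T t) 1)
       else 0) \<noteq> 0"
      then have "Poly_Mapping.lookup (c (T - {apex T t}) k) (t + Poly_Mapping.single (apex T t) 1) \<noteq> 0"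
        by (metis mult_zero_right)
      then show "t \<in> (\<Union>i. (\<lambda>t. t + Poly_Mapping.single i 1) -` Poly_Mapping.keys (c (T - {i}) k))"
        unfolding UN_iff vimage_eq in_keys_iff by blast
    qed
  qed
  then show ?thesis unfolding kcone_def by simp
qed

lemma keys_minus_single_Un:
  assumes "0 < Poly_Mapping.lookup t l"
  shows "Poly_Mapping.keys (t - Poly_Mapping.single l (1::nat)) \<union> insert l T = Poly_Mapping.keys t \<union> T"
proof -
  have "x \<in> Poly_Mapping.keys (t - Poly_Mapping.single l 1) \<or> x = l \<longleftrightarrow> x \<in> Poly_Mapping.keys t \<or> x = l" for x
    by (cases "x = l") (simp_all add: in_keys_iff lookup_minus lookup_single)
  moreover have "l \<in> Poly_Mapping.keys t"
    using assms by (simp add: in_keys_iff)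
  ultimately show ?thesis by blast
qed

text \<open>
  Every cycle is the boundary of its cone, provided that it has no component in multidegree 0,
  where there is no apex. At a pair \<open>(T, t)\<close> with apex i, only the summand of i contributes to the
  boundary of the cone if i is not in \<open>T\<close>; otherwise the vanishing of the boundary of \<open>c\<close> at
  \<open>T - {i}\<close> expresses the sum by \<open>c T\<close>.
\<close>

lemma kosz_kcone:
  fixes c :: "'n::{finite,linorder} set \<Rightarrow> nat \<Rightarrow> ('n, 'a::comm_ring_1) mpoly"
  assumes cyc: "kosz c = 0" and c0: "Poly_Mapping.lookup (c {} k) 0 = 0"
  shows "kosz (kcone c) T k = c T k"
proof (rule poly_mapping_eqI)
  fix t
  let ?L = "\<lambda>T t. Poly_Mapping.lookup (c T k) t"
  let ?e = "\<lambda>l. Poly_Mapping.single l (1::nat)"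
  let ?s = "\<lambda>l T. (-1 :: 'a) ^ card {x\<in>T. x < l}"
  define i where "i = apex T t"
  have ap: "apex (insert l T) (t - ?e l) = i" if "0 < Poly_Mapping.lookup t l" for l
    using keys_minus_single_Un[OF that] by (simp add: i_def apex_def)
  have "Poly_Mapping.lookup (kosz (kcone c) T k) t = (\<Sum>l\<in>-T. ?s l T *
      (if 0 < Poly_Mapping.lookup t l \<and> i \<in> insert l T
       then ?s i (insert l T - {i}) * ?L (insert l T - {i}) (t - ?e l + ?e i) else 0))"
    unfolding lookup_kosz lookup_kcone
    by (intro sum.cong refl) (simp add: ap del: One_nat_def cong: if_cong)
  also have "\<dots> = ?L T t"
  proof (cases "Poly_Mapping.keys t \<union> T = {}")
    case True
    then have "T = {}" "t = 0" by auto
    then show ?thesis using c0 by simp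
  next
    case ne: False
    have i: "i \<in> Poly_Mapping.keys t \<union> T"
      unfolding i_def apex_def using ne by (intro Max_in) auto
    show ?thesis
    proof (cases "i \<in> T")
      case False
      then have pos: "0 < Poly_Mapping.lookup t i" using i by (auto simp: in_keys_iff)
      have "(\<Sum>l\<in>-T. ?s l T *
        (if 0 < Poly_Mapping.lookup t l \<and> i \<in> insert l T
         then ?s i (insert l T - {i}) * ?L (insert l T - {i}) (t - ?e l + ?e i) else 0)) =
        (\<Sum>l\<in>-T. if l = i then ?L T t else 0)"
      proof (intro sum.cong refl)
        fix l assume "l \<in> - T"
        have "t - ?e i + ?e i = t" using exponent_split[OF pos] by (simp add: add.commute)
        then show "?s l T *
          (if 0 < Poly_Mapping.lookup t l \<and> i \<in> insert l T
           then ?s i (insert l T - {i}) * ?L (insert l T - {i}) (t - ?e l + ?e i) else 0) =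
           (if l = i then ?L T t else 0)"
          using False pos by (auto simp: minus_one_power_square)
      qed
      also have "\<dots> = ?L T t" using False by simp
      finally show ?thesis .
    next
      case True
      define T' where "T' = T - {i}"
      have T: "T = insert i T'" "i \<notin> T'" using True by (auto simp: T'_def)
      define X where "X l = (if 0 < Poly_Mapping.lookup t l then
        ?s l T' * ?L (insert l T') (t + ?e i - ?e l) else 0)" for l
      have "0 = Poly_Mapping.lookup (kosz c T' k) (t + ?e i)" using cyc by simp
      also have "\<dots> = (\<Sum>l\<in>insert i (-T). ?s l T' *
        (if 0 < Poly_Mapping.lookup (t + ?e i) l then ?L (insert l T') (t + ?e i - ?e l) else 0))"
        unfolding lookup_kosz using True by (intro sum.cong) (auto simp: T'_def)
      also have "\<dots> = ?s i T' * ?L T t + (\<Sum>l\<in>-T. X l)"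
      proof -
        have "(\<Sum>l\<in>-T. ?s l T' *
          (if 0 < Poly_Mapping.lookup (t + ?e i) l then ?L (insert l T') (t + ?e i - ?e l) else 0))
          = (\<Sum>l\<in>-T. X l)"
          using True by (intro sum.cong) (auto simp: X_def lookup_add lookup_single when_def)
        then show ?thesis using True by (simp add: T(1)[symmetric] lookup_add)
      qed
      finally have X: "(\<Sum>l\<in>-T. X l) = - (?s i T' * ?L T t)"
        by (metis add.inverse_unique)
      have "(\<Sum>l\<in>-T. ?s l T *
        (if 0 < Poly_Mapping.lookup t l \<and> i \<in> insert l T
         then ?s i (insert l T - {i}) * ?L (insert l T - {i}) (t - ?e l + ?e i) else 0)) =
        (\<Sum>l\<in>-T. - (?s i T' * X l))"
      proof (intro sum.cong refl)
        fix l assume l: "l \<in> - T"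
        have li: "l \<noteq> i" "l \<notin> T'" using l True by (auto simp: T'_def)
        have ins: "insert l T - {i} = insert l T'" using li by (auto simp: T'_def)
        have sg: "?s l T * ?s i (insert l T') = - (?s i T' * ?s l T')"
        proof -
          have "?s l T = (if i < l then -1 else 1) * ?s l T'"
            unfolding T(1) by (rule sign_insert[OF T(2)])
          moreover have "?s i (insert l T') = (if l < i then -1 else 1) * ?s i T'"
            by (rule sign_insert[OF li(2)])
          ultimately show ?thesis using li by (auto simp: not_less)
        qed
        show "?s l T *
          (if 0 < Poly_Mapping.lookup t l \<and> i \<in> insert l T
           then ?s i (insert l T - {i}) * ?L (insert l T - {i}) (t - ?e l + ?e i) else 0) =
          - (?s i T' * X l)"
        proof (cases "0 < Poly_Mapping.lookup t l")
          case pos: True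
          have "t - ?e l + ?e i = t + ?e i - ?e l"
            using pos by (intro poly_mapping_eqI)
              (auto simp: lookup_add lookup_minus lookup_single when_def)
          then show ?thesis
            using pos True sg unfolding ins X_def by (simp add: mult.assoc[symmetric])
        qed (simp add: X_def)
      qed
      also have "\<dots> = ?L T t"
        by (simp add: sum_negf sum_distrib_left[symmetric] X minus_one_power_square)
      finally show ?thesis .
    qed
  qed
  finally show "Poly_Mapping.lookup (kosz (kcone c) T k) t = ?L T t" .
qed

section \<open>Graded pieces of Koszul homology\<close>

text \<open>
  The component of degree j of the free module of rank r with basis vectors in degrees
  \<open>d 0, d 1, \<dots>\<close>.
\<close>

definition grd :: "nat \<Rightarrow> (nat \<Rightarrow> int) \<Rightarrow> int \<Rightarrow> (nat \<Rightarrow> ('n, 'a::comm_ring_1) mpoly) set" where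
  "grd r d j = {v \<in> free_mod r. \<forall>k<r. v k \<in> homog_comp (j - d k)}"

text \<open>
  The chains of homological degree q and internal degree j of the Koszul complex with
  coefficients in a submodule \<open>N\<close> of a graded free module; basis vectors of the q-th exterior
  power are the sets of q variables, in degree q.
\<close>

definition kchains ::
    "nat \<Rightarrow> (nat \<Rightarrow> int) \<Rightarrow> (nat \<Rightarrow> ('n, 'a::comm_ring_1) mpoly) set \<Rightarrow> nat \<Rightarrow> int \<Rightarrow>
     ('n::{finite,linorder} set \<Rightarrow> nat \<Rightarrow> ('n, 'a) mpoly) set" where
  "kchains r d N q j = {c. \<forall>T. if card T = q then c T \<in> N \<inter> grd r d (j - int q) else c T = 0}"

text \<open>Koszul homology in homological degree \<open>q\<close> and internal degree \<open>j\<close> is zero.\<close>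

definition kvanish ::
    "nat \<Rightarrow> (nat \<Rightarrow> int) \<Rightarrow> (nat \<Rightarrow> ('n::{finite,linorder}, 'a::comm_ring_1) mpoly) set \<Rightarrow>
     nat \<Rightarrow> int \<Rightarrow> bool" where
  "kvanish r d N q j \<longleftrightarrow>
     (\<forall>c\<in>kchains r d N q j. kosz c = 0 \<longrightarrow> (\<exists>b\<in>kchains r d N (Suc q) j. kosz b = c))"

lemma kchainsD:
  assumes "c \<in> kchains r d N q j"
  shows "card T = q \<Longrightarrow> c T \<in> N" "card T = q \<Longrightarrow> c T \<in> grd r d (j - int q)"
    "card T \<noteq> q \<Longrightarrow> c T = 0"
proof -
  have "if card T = q then c T \<in> N \<inter> grd r d (j - int q) else c T = 0"
    using assms unfolding kchains_def by blast
  then show "card T = q \<Longrightarrow> c T \<in> N" "card T = q \<Longrightarrow> c T \<in> grd r d (j - int q)"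
    "card T \<noteq> q \<Longrightarrow> c T = 0"
    by auto
qed

lemma kchains_in:
  assumes "vmod.subspace N" "c \<in> kchains r d N q j"
  shows "c T \<in> N"
  using kchainsD[OF assms(2), of T] vmod.subspace_0[OF assms(1)] by (cases "card T = q") auto

lemma sum_apply: "(\<Sum>x\<in>A. f x) k = (\<Sum>x\<in>A. (f x :: 'b \<Rightarrow> 'c::comm_monoid_add) k)"
  by (induction A rule: infinite_finite_induct) auto

lemma subspace_free_mod: "vmod.subspace (free_mod r)"
  by (auto simp: vmod.subspace_def free_mod_def vscale_apply)

lemma grd_subset: "grd r d j \<subseteq> free_mod r"
  by (auto simp: grd_def)

lemma grd_0 [simp]: "0 \<in> grd r d j"
  by (auto simp: grd_def free_mod_def)

lemma grd_add: "u \<in> grd r d j \<Longrightarrow> v \<in> grd r d j \<Longrightarrow> u + v \<in> grd r d j"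
  by (auto simp: grd_def free_mod_def intro: homog_comp_add)

lemma grd_diff: "u \<in> grd r d j \<Longrightarrow> v \<in> grd r d j \<Longrightarrow> u - v \<in> grd r d j"
  by (auto simp: grd_def free_mod_def intro: homog_comp_diff)

lemma grd_sum: "(\<And>x. x \<in> A \<Longrightarrow> f x \<in> grd r d j) \<Longrightarrow> sum f A \<in> grd r d j"
  by (induction A rule: infinite_finite_induct) (auto intro: grd_add)

lemma grd_vscale:
  fixes v :: "nat \<Rightarrow> ('n::finite, 'a::comm_ring_1) mpoly"
  assumes "p \<in> homog_comp e" "v \<in> grd r d j"
  shows "vscale p v \<in> grd r d (e + j)"
proof -
  have "p * v k \<in> homog_comp (e + j - d k)" if "k < r" for k
    using homog_comp_times[of p e "v k" "j - d k"] assms that by (auto simp: grd_def algebra_simps)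
  then show ?thesis using assms(2) by (auto simp: grd_def free_mod_def vscale_apply)
qed

lemma Var_homog: "Var l \<in> homog_comp 1"
  by (auto simp: Var_def monomial_def homog_comp_def)

lemma minus_one_power_homog: "p \<in> homog_comp e \<Longrightarrow> (-1) ^ m * p \<in> homog_comp e"
  by (simp add: homog_comp_iff lookup_minus_one_power_times minus_one_power_iff)

lemma kosz_eq_sum:
  "kosz c T = (\<Sum>l\<in>-T. vscale ((-1) ^ card {x\<in>T. x < l} * Var l) (c (insert l T)))"
  by (rule ext) (simp only: kosz_def sum_apply mult.assoc vscale_apply)

lemma kosz_in_kchains:
  fixes c :: "'n::{finite,linorder} set \<Rightarrow> nat \<Rightarrow> ('n, 'a::comm_ring_1) mpoly"
  assumes "vmod.subspace N" "c \<in> kchains r d N (Suc q) j"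
  shows "kosz c \<in> kchains r d N q j"
  unfolding kchains_def
proof clarify
  fix T :: "'n set"
  have c: "if card T = Suc q then c T \<in> N \<inter> grd r d (j - int (Suc q)) else c T = 0" for T
    using assms(2) unfolding kchains_def by blast
  have card: "card (insert l T) = Suc (card T)" if "l \<in> - T" for l
    using that by simp
  show "if card T = q then kosz c T \<in> N \<inter> grd r d (j - int q) else kosz c T = 0"
  proof (cases "card T = q")
    case True
    have "vscale ((-1) ^ card {x\<in>T. x < l} * Var l) (c (insert l T)) \<in> N \<inter> grd r d (j - int q)"
      if "l \<in> - T" for l
    proof -
      have cT: "c (insert l T) \<in> N" "c (insert l T) \<in> grd r d (j - int (Suc q))"
        using c[of "insert l T"] card[OF that] True by auto
      show ?thesis
        using vmod.subspace_scale[OF assms(1) cT(1)]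
          grd_vscale[OF minus_one_power_homog[OF Var_homog] cT(2)]
        by (auto simp: algebra_simps)
    qed
    then have "kosz c T \<in> N" "kosz c T \<in> grd r d (j - int q)"
      unfolding kosz_eq_sum by (auto intro!: vmod.subspace_sum[OF assms(1)] grd_sum)
    then show ?thesis using True by simp
  next
    case False
    then have "c (insert l T) = 0" if "l \<in> - T" for l
      using c[of "insert l T"] card[OF that] by simp
    then show ?thesis
      using False by (auto simp: kosz_eq_sum fun_eq_iff sum_apply vscale_apply intro!: sum.neutral)
  qed
qed

lemma kchains_diff:
  assumes "vmod.subspace N" "b \<in> kchains r d N q j" "c \<in> kchains r d N q j"
  shows "(\<lambda>T. b T - c T) \<in> kchains r d N q j"
  unfolding kchains_def
proof clarify
  fix T
  have "if card T = q then b T \<in> N \<inter> grd r d (j - int q) else b T = 0"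
    "if card T = q then c T \<in> N \<inter> grd r d (j - int q) else c T = 0"
    using assms(2,3) unfolding kchains_def by blast+
  then show "if card T = q then b T - c T \<in> N \<inter> grd r d (j - int q) else b T - c T = 0"
    using vmod.subspace_diff[OF assms(1)] grd_diff by (auto split: if_splits)
qed

lemma kchains_mono: "N \<subseteq> N' \<Longrightarrow> kchains r d N q j \<subseteq> kchains r d N' q j"
  unfolding kchains_def by (auto split: if_splits)

lemma kcone_in_kchains:
  fixes c :: "'n::{finite,linorder} set \<Rightarrow> nat \<Rightarrow> ('n, 'a::comm_ring_1) mpoly"
  assumes c: "c \<in> kchains r d (free_mod r) q j"
  shows "kcone c \<in> kchains r d (free_mod r) (Suc q) j"
  unfolding kchains_def
proof clarify
  fix T :: "'n set"
  have nz: "card T = Suc q \<and> k < r \<and> int (mon_degree t) = j - int (Suc q) - d k"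
    if "Poly_Mapping.lookup (kcone c T k) t \<noteq> 0" for k t
  proof -
    define i where "i = apex T t"
    have i: "i \<in> T" and L: "Poly_Mapping.lookup (c (T - {i}) k) (t + Poly_Mapping.single i 1) \<noteq> 0"
      using that unfolding lookup_kcone i_def by (auto split: if_splits)
    have cT: "if card (T - {i}) = q then c (T - {i}) \<in> free_mod r \<inter> grd r d (j - int q) else c (T - {i}) = 0"
      using c unfolding kchains_def by blast
    then have q: "card (T - {i}) = q" using L by (auto split: if_splits)
    then have "card T = Suc q" using i
      by (metis card_Suc_Diff1 finite)
    moreover have g: "c (T - {i}) \<in> grd r d (j - int q)" using cT q by simp
    moreover have k: "k < r"
    proof (rule ccontr)
      assume "\<not> k < r"
      then have "c (T - {i}) k = 0" using g by (auto simp: grd_def free_mod_def)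
      then show False using L by simp
    qed
    moreover have "int (mon_degree (t + Poly_Mapping.single i 1)) = j - int q - d k"
      using g k L by (auto simp: grd_def homog_comp_iff)
    ultimately show ?thesis by (simp add: mon_degree_add)
  qed
  show "if card T = Suc q then kcone c T \<in> free_mod r \<inter> grd r d (j - int (Suc q)) else kcone c T = 0"
  proof (cases "card T = Suc q")
    case True
    have "kcone c T \<in> free_mod r"
      unfolding free_mod_def using nz by (auto intro!: poly_mapping_eqI) (meson linorder_not_le)
    moreover have "kcone c T k \<in> homog_comp (j - int (Suc q) - d k)" if "k < r" for k
      unfolding homog_comp_iff using nz by blast
    ultimately show ?thesis using True by (auto simp: grd_def)
  next
    case False
    then have "Poly_Mapping.lookup (kcone c T k) t = 0" for k t
      using nz by blast
    then have "kcone c T = 0"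
      by (intro ext poly_mapping_eqI) simp
    then show ?thesis using False by simp
  qed
qed

text \<open>
  The Koszul complex of a free module is exact in positive homological degree, where the
  coefficient at the empty set is 0. In homological degree 0 the cycles without constant terms
  are boundaries.
\<close>

lemma kosz_exact_free:
  fixes c :: "'n::{finite,linorder} set \<Rightarrow> nat \<Rightarrow> ('n, 'a::comm_ring_1) mpoly"
  assumes c: "c \<in> kchains r d (free_mod r) q j" and cyc: "kosz c = 0"
    and c0: "\<And>k. Poly_Mapping.lookup (c {} k) 0 = 0"
  shows "\<exists>b\<in>kchains r d (free_mod r) (Suc q) j. kosz b = c"
  using kcone_in_kchains[OF c] kosz_kcone[OF cyc c0] by (auto simp: fun_eq_iff)

subsection \<open>Dimension shifting\<close>

lemma free_map_diff: "free_map r w (u - v) = free_map r w u - free_map r w v"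
  by (simp add: free_map_def fun_eq_iff left_diff_distrib sum_subtractf)

lemma free_map_add: "free_map r w (u + v) = free_map r w u + free_map r w v"
  by (simp add: free_map_def fun_eq_iff distrib_right sum.distrib)

lemma free_map_0 [simp]: "free_map r w 0 = 0"
  by (simp add: free_map_def fun_eq_iff)

lemma free_map_vscale: "free_map r w (vscale p v) = vscale p (free_map r w v)"
  by (rule ext) (simp only: free_map_def sum_distrib_left mult.assoc vscale_apply)

lemma free_map_sum: "free_map r w (sum f A) = (\<Sum>x\<in>A. free_map r w (f x))"
proof (induction A rule: infinite_finite_induct)
  case (insert x F)
  then show ?case by (simp only: sum.insert free_map_add not_False_eq_True)
qed (simp_all only: sum.infinite sum.empty free_map_0 not_False_eq_True)

lemma free_map_kosz: "kosz (\<lambda>T. free_map r w (c T)) = (\<lambda>T. free_map r w (kosz c T))"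
  by (rule ext) (simp only: kosz_eq_sum free_map_sum free_map_vscale)

text \<open>The kernel of \<open>free_map r w\<close> on the free module of rank \<open>r\<close>.\<close>

definition fker :: "nat \<Rightarrow> (nat \<Rightarrow> nat \<Rightarrow> 'r::comm_ring_1) \<Rightarrow> (nat \<Rightarrow> 'r) set" where
  "fker r w = {v \<in> free_mod r. free_map r w v = 0}"

lemma fker_subset: "fker r w \<subseteq> free_mod r"
  by (auto simp: fker_def)

lemma subspace_fker: "vmod.subspace (fker r w)"
proof (rule vmod.subspaceI)
  show "0 \<in> fker r w"
    using vmod.subspace_0[OF subspace_free_mod] by (simp add: fker_def)
  show "x + y \<in> fker r w" if "x \<in> fker r w" "y \<in> fker r w" for x y
  proof -
    have "free_map r w (x + y) = 0"
      using that unfolding free_map_add fker_def by simp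
    moreover have "x + y \<in> free_mod r"
      by (rule vmod.subspace_add[OF subspace_free_mod]) (use that in \<open>auto simp: fker_def\<close>)
    ultimately show ?thesis unfolding fker_def by blast
  qed
  show "vscale c x \<in> fker r w" if "x \<in> fker r w" for c x
  proof -
    have "free_map r w (vscale c x) = 0"
      using that unfolding free_map_vscale fker_def by simp
    moreover have "vscale c x \<in> free_mod r"
      by (rule vmod.subspace_scale[OF subspace_free_mod]) (use that in \<open>auto simp: fker_def\<close>)
    ultimately show ?thesis unfolding fker_def by blast
  qed
qed

lemma free_map_grd:
  fixes w :: "nat \<Rightarrow> nat \<Rightarrow> ('n::finite, 'a::comm_ring_1) mpoly"
  assumes "\<And>k. k < r' \<Longrightarrow> w k \<in> grd r d (d' k)" "v \<in> grd r' d' j"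
  shows "free_map r' w v \<in> grd r d j"
proof -
  have "free_map r' w v = (\<Sum>k<r'. vscale (v k) (w k))"
    by (rule ext) (simp only: free_map_def sum_apply vscale_apply)
  also have "\<dots> \<in> grd r d j"
  proof (rule grd_sum)
    fix k assume "k \<in> {..<r'}"
    then show "vscale (v k) (w k) \<in> grd r d j"
      using grd_vscale[of "v k" "j - d' k" "w k" r d "d' k"] assms by (auto simp: grd_def)
  qed
  finally show ?thesis .
qed

text \<open>
  A graded surjection from a graded free module onto a graded submodule \<open>N\<close> of another one;
  surjectivity is required in each degree. The k-th basis vector has degree \<open>d' k\<close> and is mapped
  to \<open>w k\<close>.
\<close>

definition graded_cover ::
    "nat \<Rightarrow> (nat \<Rightarrow> int) \<Rightarrow> (nat \<Rightarrow> ('n, 'a::comm_ring_1) mpoly) set \<Rightarrow>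
     nat \<Rightarrow> (nat \<Rightarrow> int) \<Rightarrow> (nat \<Rightarrow> nat \<Rightarrow> ('n, 'a) mpoly) \<Rightarrow> bool" where
  "graded_cover r d N r' d' w \<longleftrightarrow>
     (\<forall>k<r'. w k \<in> grd r d (d' k)) \<and> free_map r' w ` free_mod r' \<subseteq> N \<and>
     (\<forall>j. \<forall>y\<in>N \<inter> grd r d j. \<exists>v\<in>grd r' d' j. free_map r' w v = y)"

lemma kchains_lift:
  fixes w :: "nat \<Rightarrow> nat \<Rightarrow> ('n::{finite,linorder}, 'a::comm_ring_1) mpoly"
  assumes "graded_cover r d N r' d' w" "c \<in> kchains r d N q j"
  shows "\<exists>f\<in>kchains r' d' (free_mod r') q j. (\<lambda>T. free_map r' w (f T)) = c"
proof -
  have "\<forall>T. \<exists>v. (if card T = q then v \<in> grd r' d' (j - int q) else v = 0) \<and> free_map r' w v = c T"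
  proof
    fix T
    have "if card T = q then c T \<in> N \<inter> grd r d (j - int q) else c T = 0"
      using assms(2) unfolding kchains_def by blast
    then show "\<exists>v. (if card T = q then v \<in> grd r' d' (j - int q) else v = 0) \<and> free_map r' w v = c T"
      using assms(1) unfolding graded_cover_def
      by (cases "card T = q") (simp_all, blast)
  qed
  then obtain f where f: "\<And>T. if card T = q then f T \<in> grd r' d' (j - int q) else f T = 0"
    "\<And>T. free_map r' w (f T) = c T" by metis
  have "f \<in> kchains r' d' (free_mod r') q j"
    unfolding kchains_def
  proof clarify
    fix T
    show "if card T = q then f T \<in> free_mod r' \<inter> grd r' d' (j - int q) else f T = 0"
      using f(1)[of T] grd_subset[of r' d' "j - int q"] by auto
  qed
  then show ?thesis using f(2) by auto
qed

lemma kchains_free_map: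
  fixes w :: "nat \<Rightarrow> nat \<Rightarrow> ('n::{finite,linorder}, 'a::comm_ring_1) mpoly"
  assumes "graded_cover r d N r' d' w" "c \<in> kchains r' d' (free_mod r') q j"
  shows "(\<lambda>T. free_map r' w (c T)) \<in> kchains r d N q j"
  unfolding kchains_def
proof clarify
  fix T
  have w: "\<And>k. k < r' \<Longrightarrow> w k \<in> grd r d (d' k)" and im: "free_map r' w ` free_mod r' \<subseteq> N"
    using assms(1) by (auto simp: graded_cover_def)
  have "if card T = q then c T \<in> free_mod r' \<inter> grd r' d' (j - int q) else c T = 0"
    using assms(2) unfolding kchains_def by blast
  then show "if card T = q then free_map r' w (c T) \<in> N \<inter> grd r d (j - int q) else free_map r' w (c T) = 0"
    using free_map_grd[OF w] im by (auto split: if_splits)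
qed

lemma kchains_fker:
  assumes "c \<in> kchains r d (free_mod r) q j" "\<And>T. free_map r w (c T) = 0"
  shows "c \<in> kchains r d (fker r w) q j"
  using assms unfolding kchains_def fker_def by auto (metis (no_types, lifting) Int_iff)+

text \<open>
  Dimension shifting for the exact sequence formed by a cover and its kernel. A cycle with
  coefficients in \<open>N\<close> is lifted to the free module, and the boundary of the lift is a cycle with
  coefficients in the kernel, in homological degree one less.
\<close>

lemma kvanish_shift_up:
  fixes w :: "nat \<Rightarrow> nat \<Rightarrow> ('n::{finite,linorder}, 'a::comm_ring_1) mpoly"
  assumes cov: "graded_cover r d N r' d' w" and van: "kvanish r' d' (fker r' w) q j"
  shows "kvanish r d N (Suc q) j"
  unfolding kvanish_def
proof (intro ballI impI)
  fix c assume c: "c \<in> kchains r d N (Suc q) j" and cyc: "kosz c = 0"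
  obtain f where f: "f \<in> kchains r' d' (free_mod r') (Suc q) j" "(\<lambda>T. free_map r' w (f T)) = c"
    using kchains_lift[OF cov c] by blast
  have "kosz f \<in> kchains r' d' (fker r' w) q j"
  proof (rule kchains_fker)
    show "kosz f \<in> kchains r' d' (free_mod r') q j"
      using kosz_in_kchains[OF subspace_free_mod f(1)] .
    show "free_map r' w (kosz f T) = 0" for T
      using free_map_kosz[of r' w f] cyc by (simp add: f(2) fun_eq_iff)
  qed
  then obtain z where z: "z \<in> kchains r' d' (fker r' w) (Suc q) j" "kosz z = kosz f"
    using van kosz_kosz[of f] unfolding kvanish_def by blast
  have z': "z \<in> kchains r' d' (free_mod r') (Suc q) j"
    using z(1) kchains_mono[of "fker r' w" "free_mod r'"] fker_subset by blast
  have zker: "free_map r' w (z T) = 0" for T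
    using kchains_in[OF subspace_fker z(1), of T] by (simp add: fker_def)
  let ?g = "\<lambda>T. f T - z T"
  have g: "?g \<in> kchains r' d' (free_mod r') (Suc q) j"
    by (rule kchains_diff[OF subspace_free_mod f(1) z'])
  have "?g {} = 0" using g by (auto simp: kchains_def dest: spec[of _ "{}"])
  then have "\<And>k. Poly_Mapping.lookup (?g {} k) 0 = 0" by (simp add: fun_eq_iff)
  then obtain b where b: "b \<in> kchains r' d' (free_mod r') (Suc (Suc q)) j" "kosz b = ?g"
    using kosz_exact_free[OF g] z(2) by (auto simp: kosz_diff)
  have "kosz (\<lambda>T. free_map r' w (b T)) = c"
    by (simp add: free_map_kosz b(2) free_map_diff zker f(2)[symmetric])
  then show "\<exists>b\<in>kchains r d N (Suc (Suc q)) j. kosz b = c"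
    using kchains_free_map[OF cov b(1)] by blast
qed

text \<open>
  The converse. In homological degree 0, minimality of the cover is needed for a cycle
  with coefficients in the kernel to be a boundary over the free module.
\<close>

lemma kvanish_shift_down:
  fixes w :: "nat \<Rightarrow> nat \<Rightarrow> ('n::{finite,linorder}, 'a::comm_ring_1) mpoly"
  assumes cov: "graded_cover r d N r' d' w" and van: "kvanish r d N (Suc q) j"
    and minimal: "\<And>v k. v \<in> fker r' w \<Longrightarrow> Poly_Mapping.lookup (v k) 0 = 0"
  shows "kvanish r' d' (fker r' w) q j"
  unfolding kvanish_def
proof (intro ballI impI)
  fix c assume c: "c \<in> kchains r' d' (fker r' w) q j" and cyc: "kosz c = 0"
  have c': "c \<in> kchains r' d' (free_mod r') q j"
    using c kchains_mono[of "fker r' w" "free_mod r'"] fker_subset by blast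
  have ck: "c T \<in> fker r' w" for T
    by (rule kchains_in[OF subspace_fker c])
  obtain b where b: "b \<in> kchains r' d' (free_mod r') (Suc q) j" "kosz b = c"
    using kosz_exact_free[OF c' cyc minimal[OF ck]] by blast
  have "kosz (\<lambda>T. free_map r' w (b T)) = 0"
    using ck by (auto simp: free_map_kosz b(2) fker_def fun_eq_iff)
  then obtain l where l: "l \<in> kchains r d N (Suc (Suc q)) j" "kosz l = (\<lambda>T. free_map r' w (b T))"
    using van kchains_free_map[OF cov b(1)] unfolding kvanish_def by blast
  obtain f where f: "f \<in> kchains r' d' (free_mod r') (Suc (Suc q)) j" "(\<lambda>T. free_map r' w (f T)) = l"
    using kchains_lift[OF cov l(1)] by blast
  let ?g = "\<lambda>T. b T - kosz f T"
  have "?g \<in> kchains r' d' (fker r' w) (Suc q) j"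
  proof (rule kchains_fker)
    show "?g \<in> kchains r' d' (free_mod r') (Suc q) j"
      by (rule kchains_diff[OF subspace_free_mod b(1) kosz_in_kchains[OF subspace_free_mod f(1)]])
    have "(\<lambda>T. free_map r' w (kosz f T)) = (\<lambda>T. free_map r' w (b T))"
      using l(2) f(2) free_map_kosz[of r' w f] by simp
    then have "free_map r' w (kosz f T) = free_map r' w (b T)" for T
      by (rule fun_cong)
    then show "free_map r' w (?g T) = 0" for T
      unfolding free_map_diff by simp
  qed
  moreover have "kosz ?g = c"
    by (simp add: kosz_diff kosz_kosz b(2))
  ultimately show "\<exists>b\<in>kchains r' d' (fker r' w) (Suc q) j. kosz b = c" by blast
qed

section \<open>Minimal covers\<close>

text \<open>
  One step of a minimal graded free resolution: a graded surjection onto \<open>N\<close> whose kernel has no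
  constant terms.
\<close>

definition min_cover ::
    "nat \<Rightarrow> (nat \<Rightarrow> int) \<Rightarrow> (nat \<Rightarrow> ('n, 'a::comm_ring_1) mpoly) set \<Rightarrow>
     nat \<Rightarrow> (nat \<Rightarrow> int) \<Rightarrow> (nat \<Rightarrow> nat \<Rightarrow> ('n, 'a) mpoly) \<Rightarrow> bool" where
  "min_cover r d N r' d' w \<longleftrightarrow>
     (\<forall>k<r'. w k \<in> grd r d (d' k)) \<and> free_map r' w ` free_mod r' = N \<and>
     (\<forall>v\<in>fker r' w. \<forall>k. Poly_Mapping.lookup (v k) 0 = 0)"

text \<open>The component of degree \<open>j\<close> of a vector, where the k-th basis vector has degree \<open>d k\<close>.\<close>

definition hpart ::
    "nat \<Rightarrow> (nat \<Rightarrow> int) \<Rightarrow> int \<Rightarrow> (nat \<Rightarrow> ('n, 'a::comm_ring_1) mpoly) \<Rightarrow> nat \<Rightarrow> ('n, 'a) mpoly" where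
  "hpart r d j v = (\<lambda>k. if k < r then hcomp (j - d k) (v k) else 0)"

lemma hpart_grd: "hpart r d j v \<in> grd r d j"
  by (auto simp: hpart_def grd_def free_mod_def hcomp_in_homog_comp)

lemma hpart_eq: "v \<in> grd r d j \<Longrightarrow> hpart r d j v = v"
  by (auto simp: hpart_def grd_def free_mod_def fun_eq_iff hcomp_homog)

lemma hpart_0 [simp]: "hpart r d j 0 = 0"
  by (auto simp: hpart_def fun_eq_iff)

lemma hpart_free_map:
  fixes w :: "nat \<Rightarrow> nat \<Rightarrow> ('n::finite, 'a::comm_ring_1) mpoly"
  assumes "\<And>k. k < r' \<Longrightarrow> w k \<in> grd r d (d' k)"
  shows "free_map r' w (hpart r' d' j v) = hpart r d j (free_map r' w v)"
proof
  fix l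
  show "free_map r' w (hpart r' d' j v) l = hpart r d j (free_map r' w v) l"
  proof (cases "l < r")
    case True
    have "hcomp (j - d' k) (v k) * w k l = hcomp (j - d l) (v k * w k l)" if "k < r'" for k
      using hcomp_times[of "w k l" "d' k - d l" "j - d l" "v k"] assms[OF that] True
      by (auto simp: grd_def)
    then show ?thesis
      using True by (simp add: hpart_def free_map_def hcomp_sum)
  next
    case False
    then have "w k l = 0" if "k < r'" for k
      using assms[OF that] by (auto simp: grd_def free_mod_def)
    then show ?thesis
      using False by (simp add: hpart_def free_map_def)
  qed
qed

lemma min_cover_graded_cover:
  fixes w :: "nat \<Rightarrow> nat \<Rightarrow> ('n::finite, 'a::comm_ring_1) mpoly"
  assumes "min_cover r d N r' d' w"
  shows "graded_cover r d N r' d' w"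
proof -
  have w: "\<And>k. k < r' \<Longrightarrow> w k \<in> grd r d (d' k)" and im: "free_map r' w ` free_mod r' = N"
    using assms by (auto simp: min_cover_def)
  have "\<exists>v\<in>grd r' d' j. free_map r' w v = y" if "y \<in> N \<inter> grd r d j" for j y
  proof -
    have "y \<in> free_map r' w ` free_mod r'" using im that by blast
    then obtain v where "free_map r' w v = y" by blast
    then have "free_map r' w (hpart r' d' j v) = y"
      using hpart_free_map[where w = w and r = r and d = d, OF w] hpart_eq that by auto
    then show ?thesis using hpart_grd by blast
  qed
  then show ?thesis using w im unfolding graded_cover_def by blast
qed

lemma kosz_kchains_0:
  assumes "c \<in> kchains r d N 0 j"
  shows "kosz c = 0"
proof -
  have "c (insert l T) = 0" for l T
    by (rule kchainsD(3)[OF assms]) (simp add: card_eq_0_iff)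
  then show ?thesis by (simp add: kosz_def fun_eq_iff)
qed

text \<open>
  The degrees of the minimal generators of \<open>N\<close> are the internal degrees in which the Koszul
  homology in homological degree 0 is nonzero. Chains in homological degree 0 live on the
  empty set of variables.
\<close>

lemma kvanish_0_iff:
  fixes w :: "nat \<Rightarrow> nat \<Rightarrow> ('n::{finite,linorder}, 'a::comm_ring_1) mpoly"
  assumes mc: "min_cover r d N r' d' w"
  shows "kvanish r d N 0 j \<longleftrightarrow> \<not> (\<exists>k<r'. d' k = j)"
proof
  have cov: "graded_cover r d N r' d' w" by (rule min_cover_graded_cover[OF mc])
  have w: "\<And>k. k < r' \<Longrightarrow> w k \<in> grd r d (d' k)" and im: "free_map r' w ` free_mod r' = N"
    and minimal: "\<And>v k. v \<in> fker r' w \<Longrightarrow> Poly_Mapping.lookup (v k) 0 = 0"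
    using mc by (auto simp: min_cover_def)
  {
    assume van: "kvanish r d N 0 j"
    show "\<not> (\<exists>k<r'. d' k = j)"
    proof
      assume "\<exists>k<r'. d' k = j"
      then obtain k where k: "k < r'" "d' k = j" by blast
      define e :: "nat \<Rightarrow> ('n, 'a) mpoly" where "e l = (if l = k then 1 else 0)" for l
      have e: "e \<in> grd r' d' j"
        using k by (auto simp: grd_def free_mod_def e_def homog_comp_def)
      have eF: "e \<in> free_mod r'" using e grd_subset by blast
      define c :: "'n set \<Rightarrow> nat \<Rightarrow> ('n, 'a) mpoly" where
        "c T = (if T = {} then free_map r' w e else 0)" for T
      have c: "c \<in> kchains r d N 0 j"
        unfolding kchains_def
      proof clarify
        fix T :: "'n set"
        have "free_map r' w e \<in> N" using im eF by blast
        then show "if card T = 0 then c T \<in> N \<inter> grd r d (j - int 0) else c T = 0"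
          using free_map_grd[OF w e] by (auto simp: c_def card_eq_0_iff)
      qed
      obtain b where b: "b \<in> kchains r d N (Suc 0) j" "kosz b = c"
        using van c kosz_kchains_0[OF c] unfolding kvanish_def by blast
      obtain f where f: "f \<in> kchains r' d' (free_mod r') (Suc 0) j" "(\<lambda>T. free_map r' w (f T)) = b"
        using kchains_lift[OF cov b(1)] by blast
      have "free_map r' w (kosz f {}) = free_map r' w e"
        using free_map_kosz[of r' w f] f(2) b(2) c_def[of "{}"] by (metis (full_types))
      moreover have "kosz f {} \<in> free_mod r'"
        using kchains_in[OF subspace_free_mod kosz_in_kchains[OF subspace_free_mod f(1)]] .
      ultimately have "e - kosz f {} \<in> fker r' w"
        using vmod.subspace_diff[OF subspace_free_mod eF] by (auto simp: fker_def free_map_diff)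
      then have "Poly_Mapping.lookup ((e - kosz f {}) k) 0 = 0"
        by (rule minimal)
      then show False
        by (simp add: lookup_minus e_def lookup_kosz)
    qed
  }
  {
    assume nk: "\<not> (\<exists>k<r'. d' k = j)"
    show "kvanish r d N 0 j"
      unfolding kvanish_def
    proof (intro ballI impI)
      fix c assume c: "c \<in> kchains r d N 0 j"
      obtain f where f: "f \<in> kchains r' d' (free_mod r') 0 j" "(\<lambda>T. free_map r' w (f T)) = c"
        using kchains_lift[OF cov c] by blast
      have fe: "f {} \<in> grd r' d' j" using kchainsD(2)[OF f(1), of "{}"] by simp
      have "Poly_Mapping.lookup (f {} k) 0 = 0" for k
      proof (cases "k < r'")
        case True
        then show ?thesis
          using fe nk homog_comp_lookup_0[of "f {} k" "j - d' k"] by (auto simp: grd_def)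
      next
        case False
        then show ?thesis using fe by (auto simp: grd_def free_mod_def)
      qed
      then obtain b where b: "b \<in> kchains r' d' (free_mod r') (Suc 0) j" "kosz b = f"
        using kosz_exact_free[OF f(1) kosz_kchains_0[OF f(1)]] by blast
      have "kosz (\<lambda>T. free_map r' w (b T)) = c"
        using b(2) f(2) by (simp add: free_map_kosz)
      then show "\<exists>b\<in>kchains r d N (Suc 0) j. kosz b = c"
        using kchains_free_map[OF cov b(1)] by blast
    qed
  }
qed

lemma kvanish_shift:
  fixes w :: "nat \<Rightarrow> nat \<Rightarrow> ('n::{finite,linorder}, 'a::comm_ring_1) mpoly"
  assumes mc: "min_cover r d N r' d' w"
  shows "kvanish r' d' (fker r' w) q j \<longleftrightarrow> kvanish r d N (Suc q) j"
proof
  have cov: "graded_cover r d N r' d' w" by (rule min_cover_graded_cover[OF mc])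
  have minimal: "\<And>v k. v \<in> fker r' w \<Longrightarrow> Poly_Mapping.lookup (v k) 0 = 0"
    using mc unfolding min_cover_def by blast
  show "kvanish r d N (Suc q) j" if "kvanish r' d' (fker r' w) q j"
    by (rule kvanish_shift_up[OF cov that])
  show "kvanish r' d' (fker r' w) q j" if "kvanish r d N (Suc q) j"
    by (rule kvanish_shift_down[OF cov that]) (rule minimal)
qed

section \<open>Existence of minimal covers\<close>

text \<open>The structure of a vector space over the field of coefficients.\<close>

definition kscale :: "'a::field \<Rightarrow> (nat \<Rightarrow> ('n, 'a) mpoly) \<Rightarrow> nat \<Rightarrow> ('n, 'a) mpoly" where
  "kscale a v = vscale (Poly_Mapping.single 0 a) v"

interpretation kvec: vector_space "kscale :: 'a::field \<Rightarrow> (nat \<Rightarrow> ('n, 'a) mpoly) \<Rightarrow> nat \<Rightarrow> ('n, 'a) mpoly"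
proof unfold_locales
  fix a b :: 'a and x y :: "nat \<Rightarrow> ('n, 'a) mpoly"
  show "kscale a (x + y) = kscale a x + kscale a y"
    unfolding kscale_def by (rule vmod.scale_right_distrib)
  show "kscale (a + b) x = kscale a x + kscale b x"
    unfolding kscale_def single_add by (rule vmod.scale_left_distrib)
  show "kscale a (kscale b x) = kscale (a * b) x"
    unfolding kscale_def vmod.scale_scale by (simp add: mult_single)
  show "kscale 1 x = x"
    unfolding kscale_def by simp
qed

lemma finite_mon_degree_le: "finite {t :: 'n::finite \<Rightarrow>\<^sub>0 nat. mon_degree t \<le> D}"
proof (rule finite_imageD)
  have "Poly_Mapping.lookup t i \<le> D" if "mon_degree t \<le> D" for t :: "'n \<Rightarrow>\<^sub>0 nat" and i
    using member_le_sum[of i UNIV "Poly_Mapping.lookup t"] that by (simp add: mon_degree_UNIV)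
  then have "Poly_Mapping.lookup ` {t :: 'n \<Rightarrow>\<^sub>0 nat. mon_degree t \<le> D} \<subseteq>
      {f. \<forall>x. (x \<in> UNIV \<longrightarrow> f x \<in> {..D}) \<and> (x \<notin> UNIV \<longrightarrow> f x = 0)}"
    by auto
  then show "finite (Poly_Mapping.lookup ` {t :: 'n \<Rightarrow>\<^sub>0 nat. mon_degree t \<le> D})"
    by (rule finite_subset) (intro finite_set_of_finite_funs; simp)
  show "inj_on Poly_Mapping.lookup {t :: 'n \<Rightarrow>\<^sub>0 nat. mon_degree t \<le> D}"
    by (rule inj_onI, rule poly_mapping_eqI) simp
qed

lemma poly_mapping_sum_single:
  "p = (\<Sum>t\<in>Poly_Mapping.keys p. Poly_Mapping.single t (Poly_Mapping.lookup p t))"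
proof (rule poly_mapping_eqI)
  fix k
  have "(\<Sum>t\<in>Poly_Mapping.keys p. Poly_Mapping.lookup (Poly_Mapping.single t (Poly_Mapping.lookup p t)) k)
    = (\<Sum>t\<in>Poly_Mapping.keys p. if t = k then Poly_Mapping.lookup p k else 0)"
    by (intro sum.cong refl) (simp add: lookup_single when_def)
  also have "\<dots> = Poly_Mapping.lookup p k"
    by (simp add: in_keys_iff)
  finally show "Poly_Mapping.lookup p k = Poly_Mapping.lookup
    (\<Sum>t\<in>Poly_Mapping.keys p. Poly_Mapping.single t (Poly_Mapping.lookup p t)) k"
    by (simp add: lookup_sum)
qed

lemma bounded_degree_span:
  fixes v :: "nat \<Rightarrow> ('n::finite, 'a::field) mpoly"
  assumes "v \<in> free_mod r" "\<And>k t. k < r \<Longrightarrow> t \<in> Poly_Mapping.keys (v k) \<Longrightarrow> mon_degree t \<le> D"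
  shows "v \<in> kvec.span ((\<lambda>(k, t) l. if l = k then Poly_Mapping.single t 1 else 0) `
    ({..<r} \<times> {t. mon_degree t \<le> D}))" (is "v \<in> kvec.span ?T")
proof -
  let ?e = "\<lambda>k t l. if l = k then Poly_Mapping.single t (1::'a) else 0"
  have v: "v = (\<Sum>k<r. \<Sum>t\<in>Poly_Mapping.keys (v k). kscale (Poly_Mapping.lookup (v k) t) (?e k t))"
  proof
    fix l
    have "(\<Sum>k<r. \<Sum>t\<in>Poly_Mapping.keys (v k). kscale (Poly_Mapping.lookup (v k) t) (?e k t)) l =
      (\<Sum>k<r. \<Sum>t\<in>Poly_Mapping.keys (v k). if l = k then Poly_Mapping.single t (Poly_Mapping.lookup (v k) t) else 0)"
      by (simp add: sum_apply kscale_def vscale_apply if_distrib mult_single cong: if_cong)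
    also have "\<dots> = (\<Sum>k<r. if l = k then v k else 0)"
    proof (intro sum.cong refl)
      fix k
      show "(\<Sum>t\<in>Poly_Mapping.keys (v k). if l = k then Poly_Mapping.single t (Poly_Mapping.lookup (v k) t) else 0)
        = (if l = k then v k else 0)"
        using poly_mapping_sum_single[of "v k"] by (cases "l = k") simp_all
    qed
    also have "\<dots> = v l"
      using assms(1) by (simp add: free_mod_def)
    finally show "v l = (\<Sum>k<r. \<Sum>t\<in>Poly_Mapping.keys (v k). kscale (Poly_Mapping.lookup (v k) t) (?e k t)) l"
      by simp
  qed
  have "?e k t \<in> ?T" if "k < r" "t \<in> Poly_Mapping.keys (v k)" for k t
    using assms(2)[OF that] that(1) by auto
  then have "kscale (Poly_Mapping.lookup (v k) t) (?e k t) \<in> kvec.span ?T"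
    if "k < r" "t \<in> Poly_Mapping.keys (v k)" for k t
    using that by (blast intro: kvec.span_scale kvec.span_base)
  then have "(\<Sum>k<r. \<Sum>t\<in>Poly_Mapping.keys (v k). kscale (Poly_Mapping.lookup (v k) t) (?e k t))
    \<in> kvec.span ?T"
    by (intro kvec.span_sum) (simp only: lessThan_iff)
  then show ?thesis using v by metis
qed

text \<open>Graded submodules of a graded free module.\<close>

definition graded_sub ::
    "nat \<Rightarrow> (nat \<Rightarrow> int) \<Rightarrow> (nat \<Rightarrow> ('n, 'a::comm_ring_1) mpoly) set \<Rightarrow> bool" where
  "graded_sub r d N \<longleftrightarrow> vmod.subspace N \<and> N \<subseteq> free_mod r \<and> (\<forall>v\<in>N. \<forall>j. hpart r d j v \<in> N)"

lemma graded_sub_fker: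
  fixes w :: "nat \<Rightarrow> nat \<Rightarrow> ('n::finite, 'a::comm_ring_1) mpoly"
  assumes "\<And>k. k < r' \<Longrightarrow> w k \<in> grd r d (d' k)"
  shows "graded_sub r' d' (fker r' w)"
  unfolding graded_sub_def
proof (intro conjI ballI allI subspace_fker fker_subset)
  fix v j assume "v \<in> fker r' w"
  then have "free_map r' w (hpart r' d' j v) = 0"
    using hpart_free_map[where w = w and r = r and d = d, OF assms] by (simp add: fker_def)
  moreover have "hpart r' d' j v \<in> free_mod r'"
    using hpart_grd grd_subset by blast
  ultimately show "hpart r' d' j v \<in> fker r' w" by (simp add: fker_def)
qed

lemma sum_hpart:
  assumes "v \<in> free_mod r"
  shows "\<exists>J. finite J \<and> v = (\<Sum>j\<in>J. hpart r d j v)"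
proof -
  define J where "J = (\<Union>k<r. (\<lambda>t. int (mon_degree t) + d k) ` Poly_Mapping.keys (v k))"
  have fin: "finite J" unfolding J_def by auto
  have "v k = (\<Sum>j\<in>J. hpart r d j v k)" for k
  proof (cases "k < r")
    case True
    have "(\<Sum>j\<in>J. hcomp (j - d k) (v k)) = (\<Sum>e\<in>(\<lambda>j. j - d k) ` J. hcomp e (v k))"
      by (subst sum.reindex) (auto simp: inj_on_def)
    also have "\<dots> = v k"
    proof (rule sum_hcomp)
      fix t assume "t \<in> Poly_Mapping.keys (v k)"
      then have "int (mon_degree t) + d k \<in> J" using True unfolding J_def by auto
      then show "int (mon_degree t) \<in> (\<lambda>j. j - d k) ` J" by force
    qed (use fin in simp)
    finally show ?thesis using True by (simp add: hpart_def)
  next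
    case False
    then show ?thesis using assms by (simp add: hpart_def free_mod_def)
  qed
  then show ?thesis using fin by (auto simp: fun_eq_iff sum_apply)
qed

lemma kspan_subset_span: "kvec.span B \<subseteq> vmod.span B"
proof (rule kvec.span_minimal)
  show "kvec.subspace (vmod.span B)"
    unfolding kvec.subspace_def kscale_def
    by (auto intro: vmod.span_zero vmod.span_add vmod.span_scale)
qed (rule vmod.span_superset)

text \<open>
  The homogeneous elements of degree at most \<open>B\<close> lie in a vector space of finite dimension, and a
  maximal linearly independent set of them generates \<open>N\<close>: in higher degrees, vanishing of Koszul
  homology in homological degree 0 says that each element is a combination of elements of lower
  degree with the variables as coefficients.
\<close>

lemma finite_homogeneous_generators:
  fixes N :: "(nat \<Rightarrow> ('n::{finite,linorder}, 'a::field) mpoly) set"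
  assumes gr: "graded_sub r d N" and van: "\<And>j. j > B \<Longrightarrow> kvanish r d N 0 j"
  shows "\<exists>W. finite W \<and> (\<forall>z\<in>W. \<exists>j. z \<in> grd r d j) \<and> vmod.span W = N"
proof -
  have sub: "vmod.subspace N" and NF: "N \<subseteq> free_mod r" and hN: "\<And>v j. v \<in> N \<Longrightarrow> hpart r d j v \<in> N"
    using gr by (auto simp: graded_sub_def)
  define H where "H = {z \<in> N. \<exists>j\<le>B. z \<in> grd r d j}"
  define D where "D = (\<Sum>k<r. nat (B - d k))"
  define T :: "(nat \<Rightarrow> ('n, 'a) mpoly) set" where
    "T = (\<lambda>(k, t) l. if l = k then Poly_Mapping.single t 1 else 0) ` ({..<r} \<times> {t. mon_degree t \<le> D})"
  have finT: "finite T" unfolding T_def by (intro finite_imageI finite_cartesian_product finite_mon_degree_le) auto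
  have HT: "H \<subseteq> kvec.span T"
  proof
    fix z assume "z \<in> H"
    then obtain j where j: "j \<le> B" "z \<in> grd r d j" by (auto simp: H_def)
    show "z \<in> kvec.span T"
      unfolding T_def
    proof (rule bounded_degree_span)
      show "z \<in> free_mod r" using j grd_subset by blast
      fix k t assume k: "k < r" and t: "t \<in> Poly_Mapping.keys (z k)"
      have "int (mon_degree t) = j - d k"
        using j(2) k t by (auto simp: grd_def homog_comp_def)
      then have "mon_degree t \<le> nat (B - d k)" using j(1) by linarith
      also have "\<dots> \<le> D" unfolding D_def using k by (intro member_le_sum) auto
      finally show "mon_degree t \<le> D" .
    qed
  qed
  obtain W where W: "W \<subseteq> H" "kvec.independent W" "H \<subseteq> kvec.span W"
    using kvec.maximal_independent_subset by blast
  have finW: "finite W"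
    using kvec.independent_span_bound[OF finT W(2)] W(1) HT by blast
  have homog: "z \<in> vmod.span W" if "z \<in> N" "z \<in> grd r d j" for z j
  proof (cases "j \<le> B")
    case True
    then show ?thesis using that W(3) kspan_subset_span unfolding H_def by blast
  next
    case False
    have *: "x \<in> vmod.span W" if "x \<in> N" "x \<in> grd r d (B + int m)" for x m
      using that
    proof (induction m arbitrary: x)
      case 0
      then have "x \<in> H" unfolding H_def by auto
      then show ?case using W(3) kspan_subset_span by blast
    next
      case (Suc m)
      let ?j = "B + int (Suc m)"
      define c :: "'n set \<Rightarrow> nat \<Rightarrow> ('n, 'a) mpoly" where "c T = (if T = {} then x else 0)" for T
      have c: "c \<in> kchains r d N 0 ?j"
        unfolding kchains_def
      proof clarify
        fix T :: "'n set"
        show "if card T = 0 then c T \<in> N \<inter> grd r d (?j - int 0) else c T = 0"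
          using Suc.prems by (auto simp: c_def card_eq_0_iff)
      qed
      obtain b where b: "b \<in> kchains r d N (Suc 0) ?j" "kosz b = c"
        using van[of ?j] c kosz_kchains_0[OF c] unfolding kvanish_def by auto
      have "b (insert l {}) \<in> vmod.span W" for l
      proof -
        have "b {l} \<in> N" "b {l} \<in> grd r d (B + int m)"
          using kchainsD(1,2)[OF b(1), of "{l}"] by auto
        then show ?thesis by (rule Suc.IH)
      qed
      then have "kosz b {} \<in> vmod.span W"
        unfolding kosz_eq_sum by (intro vmod.span_sum vmod.span_scale)
      moreover have "kosz b {} = x" by (simp add: b(2) c_def)
      ultimately show ?case by simp
    qed
    have "B + int (nat (j - B)) = j" using False by simp
    then have "z \<in> grd r d (B + int (nat (j - B)))" using that(2) by simp
    then show ?thesis by (rule *[OF that(1)])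
  qed
  have "vmod.span W = N"
  proof
    show "vmod.span W \<subseteq> N" using W(1) sub unfolding H_def by (intro vmod.span_minimal) auto
    show "N \<subseteq> vmod.span W"
    proof
      fix v assume v: "v \<in> N"
      then obtain J where J: "finite J" "v = (\<Sum>j\<in>J. hpart r d j v)"
        using sum_hpart NF by blast
      show "v \<in> vmod.span W"
        by (subst J(2)) (intro vmod.span_sum homog[OF hN[OF v] hpart_grd])
    qed
  qed
  then show ?thesis using finW W(1) unfolding H_def by blast
qed

lemma free_map_eq_sum: "free_map r w v = (\<Sum>k<r. vscale (v k) (w k))"
  by (rule ext) (simp only: free_map_def sum_apply vscale_apply)

lemma free_map_image_span:
  "free_map (card W) h ` free_mod (card W) = vmod.span W" if h: "bij_betw h {..<card W} W" and fin: "finite W"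
proof
  have hW: "h k \<in> W" if "k < card W" for k using h that by (auto simp: bij_betw_def)
  show "free_map (card W) h ` free_mod (card W) \<subseteq> vmod.span W"
  proof clarify
    fix v
    show "free_map (card W) h v \<in> vmod.span W"
      unfolding free_map_eq_sum
      by (intro vmod.span_sum vmod.span_scale vmod.span_base hW) simp
  qed
  show "vmod.span W \<subseteq> free_map (card W) h ` free_mod (card W)"
  proof
    fix x assume "x \<in> vmod.span W"
    then obtain u where u: "x = (\<Sum>y\<in>W. vscale (u y) y)"
      unfolding vmod.span_finite[OF fin] by blast
    let ?v = "\<lambda>k. if k < card W then u (h k) else 0"
    have "x = (\<Sum>k<card W. vscale (u (h k)) (h k))"
      unfolding u by (rule sum.reindex_bij_betw[OF h, symmetric])
    also have "\<dots> = free_map (card W) h ?v"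
      unfolding free_map_eq_sum by (intro sum.cong refl) simp
    finally have "x = free_map (card W) h ?v" .
    moreover have "?v \<in> free_mod (card W)" by (simp add: free_mod_def)
    ultimately show "x \<in> free_map (card W) h ` free_mod (card W)"
      by (rule image_eqI[where f = "free_map (card W) h" and x = ?v])
  qed
qed

text \<open>
  A homogeneous generating set of least cardinality gives a minimal cover: a relation with a
  nonzero constant coefficient would make one generator superfluous.
\<close>

lemma exists_min_cover:
  fixes N :: "(nat \<Rightarrow> ('n::{finite,linorder}, 'a::field) mpoly) set"
  assumes gr: "graded_sub r d N" and van: "\<And>j. j > B \<Longrightarrow> kvanish r d N 0 j"
  shows "\<exists>r' d' w. min_cover r d N r' d' w"
proof -
  let ?P = "\<lambda>W. finite W \<and> (\<forall>z\<in>W. \<exists>j. z \<in> grd r d j) \<and> vmod.span W = N"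
  obtain W0 where W0: "?P W0"
    using finite_homogeneous_generators[OF gr van] by blast
  have "\<exists>W. ?P W \<and> (\<forall>W'. ?P W' \<longrightarrow> card W \<le> card W')"
    by (rule ex_has_least_nat[of ?P, OF W0])
  then obtain W where W: "?P W" and least: "\<And>W'. ?P W' \<Longrightarrow> card W \<le> card W'"
    by blast
  then have fin: "finite W" and span: "vmod.span W = N" by auto
  define s where "s = card W"
  obtain h where h: "bij_betw h {..<s} W"
    using ex_bij_betw_nat_finite[OF fin] unfolding s_def atLeast0LessThan by blast
  have hW: "h k \<in> W" if "k < s" for k using h that by (auto simp: bij_betw_def)
  then have "\<forall>k. \<exists>j. k < s \<longrightarrow> h k \<in> grd r d j" using W by blast
  then obtain d' where d': "\<And>k. k < s \<Longrightarrow> h k \<in> grd r d (d' k)" by metis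
  have minimal: "Poly_Mapping.lookup (v k) 0 = 0" if v: "v \<in> fker s h" for v k
  proof (rule ccontr)
    assume nz: "Poly_Mapping.lookup (v k) 0 \<noteq> 0"
    have k: "k < s"
    proof (rule ccontr)
      assume "\<not> k < s"
      then have "v k = 0" using v by (simp add: fker_def free_mod_def)
      then show False using nz by simp
    qed
    define a where "a = Poly_Mapping.lookup (v k) 0"
    define u where "u = hpart s d' (d' k) v"
    have "free_map s h u = 0"
      using hpart_free_map[where w = h and r = r and d = d and r' = s and d' = d', OF d'] v
      unfolding u_def by (simp add: fker_def)
    then have z: "(\<Sum>l<s. vscale (u l) (h l)) = 0" by (simp add: free_map_eq_sum)
    have uk: "u k = Poly_Mapping.single 0 a"
    proof (rule poly_mapping_eqI)
      fix t :: "'n \<Rightarrow>\<^sub>0 nat"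
      show "Poly_Mapping.lookup (u k) t = Poly_Mapping.lookup (Poly_Mapping.single 0 a) t"
        using k by (auto simp: u_def hpart_def lookup_hcomp a_def lookup_single when_def mon_degree_eq_0_iff)
    qed
    have "vscale (u k) (h k) + (\<Sum>l\<in>{..<s} - {k}. vscale (u l) (h l)) = 0"
      using z k by (subst (asm) sum.remove[of _ k]) auto
    then have e: "vscale (u k) (h k) = - (\<Sum>l\<in>{..<s} - {k}. vscale (u l) (h l))"
      by (simp only: eq_neg_iff_add_eq_0)
    have "h l \<in> W - {h k}" if "l \<in> {..<s} - {k}" for l
      using that h k by (auto simp: bij_betw_def inj_on_def)
    then have "vscale (u k) (h k) \<in> vmod.span (W - {h k})"
      unfolding e by (intro vmod.span_neg vmod.span_sum vmod.span_scale vmod.span_base)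
    then have "vscale (Poly_Mapping.single 0 (inverse a)) (vscale (u k) (h k)) \<in> vmod.span (W - {h k})"
      by (rule vmod.span_scale)
    moreover have "vscale (Poly_Mapping.single 0 (inverse a)) (vscale (u k) (h k)) = h k"
      using nz by (simp add: uk mult_single a_def)
    ultimately have "h k \<in> vmod.span (W - {h k})" by simp
    then have "W \<subseteq> vmod.span (W - {h k})"
      using vmod.span_superset[of "W - {h k}"] by blast
    then have "vmod.span W \<subseteq> vmod.span (W - {h k})"
      by (rule vmod.span_minimal) (rule vmod.subspace_span)
    moreover have "vmod.span (W - {h k}) \<subseteq> vmod.span W"
      by (rule vmod.span_mono) blast
    ultimately have "vmod.span (W - {h k}) = N" using span by blast
    then have "?P (W - {h k})" using W by blast
    then have "card W \<le> card (W - {h k})" by (rule least)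
    moreover have "card (W - {h k}) < card W"
      using hW[OF k] fin by (rule card_Diff1_less[rotated])
    ultimately show False by simp
  qed
  have "free_map s h ` free_mod s = N"
    using free_map_image_span[OF h[unfolded s_def] fin] span unfolding s_def by simp
  then have "min_cover r d N s d' h"
    unfolding min_cover_def using d' minimal by blast
  then show ?thesis by blast
qed

section \<open>Minimal resolutions and Koszul homology\<close>

text \<open>
  The modules covered in a resolution of \<open>N\<close>: first \<open>N\<close> itself, then the successive syzygy
  modules. The free modules have ranks \<open>R 1, R 2, \<dots>\<close>, while \<open>R 0\<close> is the rank of the
  free module that contains \<open>N\<close>; the m-th map goes from rank \<open>R (Suc m)\<close> to rank \<open>R m\<close>.
\<close>

definition stage :: "(nat \<Rightarrow> 'r::comm_ring_1) set \<Rightarrow> (nat \<Rightarrow> nat) \<Rightarrow> (nat \<Rightarrow> nat \<Rightarrow> nat \<Rightarrow> 'r) \<Rightarrow>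
    nat \<Rightarrow> (nat \<Rightarrow> 'r) set" where
  "stage N R W i = (case i of 0 \<Rightarrow> N | Suc m \<Rightarrow> fker (R (Suc m)) (W m))"

text \<open>
  Minimal graded free resolutions as sequences of minimal covers; \<open>D i\<close> are the degrees of the
  basis vectors of the free module of rank \<open>R i\<close>.
\<close>

definition resolution ::
    "(nat \<Rightarrow> ('n, 'a::comm_ring_1) mpoly) set \<Rightarrow> (nat \<Rightarrow> nat) \<Rightarrow> (nat \<Rightarrow> nat \<Rightarrow> int) \<Rightarrow>
     (nat \<Rightarrow> nat \<Rightarrow> nat \<Rightarrow> ('n, 'a) mpoly) \<Rightarrow> bool" where
  "resolution N R D W \<longleftrightarrow>
     (\<forall>i. min_cover (R i) (D i) (stage N R W i) (R (Suc i)) (D (Suc i)) (W i))"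

lemma kvanish_stage:
  fixes N :: "(nat \<Rightarrow> ('n::{finite,linorder}, 'a::comm_ring_1) mpoly) set"
  assumes "resolution N R D W"
  shows "kvanish (R p) (D p) (stage N R W p) q j \<longleftrightarrow> kvanish (R 0) (D 0) N (p + q) j"
proof (induction p arbitrary: q)
  case 0
  then show ?case by (simp add: stage_def)
next
  case (Suc p)
  have "min_cover (R p) (D p) (stage N R W p) (R (Suc p)) (D (Suc p)) (W p)"
    using assms by (simp add: resolution_def)
  then have "kvanish (R (Suc p)) (D (Suc p)) (stage N R W (Suc p)) q j \<longleftrightarrow>
      kvanish (R p) (D p) (stage N R W p) (Suc q) j"
    using kvanish_shift by (simp add: stage_def)
  then show ?case by (simp add: Suc.IH)
qed

lemma resolution_degrees:
  fixes N :: "(nat \<Rightarrow> ('n::{finite,linorder}, 'a::comm_ring_1) mpoly) set"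
  assumes "resolution N R D W"
  shows "(\<exists>k<R (Suc i). D (Suc i) k = j) \<longleftrightarrow> \<not> kvanish (R 0) (D 0) N i j"
proof -
  have "min_cover (R i) (D i) (stage N R W i) (R (Suc i)) (D (Suc i)) (W i)"
    using assms by (simp add: resolution_def)
  then have "kvanish (R i) (D i) (stage N R W i) 0 j \<longleftrightarrow> \<not> (\<exists>k<R (Suc i). D (Suc i) k = j)"
    by (rule kvanish_0_iff)
  moreover have "kvanish (R i) (D i) (stage N R W i) 0 j \<longleftrightarrow> kvanish (R 0) (D 0) N i j"
    using kvanish_stage[OF assms, of i 0 j] by simp
  ultimately show ?thesis by blast
qed

lemma exists_resolution:
  fixes N :: "(nat \<Rightarrow> ('n::{finite,linorder}, 'a::field) mpoly) set"
  assumes gr: "graded_sub r d N" and van: "\<And>q. \<exists>B. \<forall>j>B. kvanish r d N q j"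
  shows "\<exists>R D W. R 0 = r \<and> D 0 = d \<and> resolution N R D W"
proof -
  let ?P = "\<lambda>n (r', d', N'). graded_sub r' d' N' \<and> (\<forall>q. \<exists>B. \<forall>j>B. kvanish r' d' N' q j) \<and>
    (n = 0 \<longrightarrow> r' = r \<and> d' = d \<and> N' = N)"
  let ?Q = "\<lambda>n (r1, d1, N1) (r2, d2, N2). \<exists>w. min_cover r1 d1 N1 r2 d2 w \<and> N2 = fker r2 w"
  have "\<exists>f :: nat \<Rightarrow> nat \<times> (nat \<Rightarrow> int) \<times> (nat \<Rightarrow> ('n, 'a) mpoly) set.
    \<forall>n. ?P n (f n) \<and> ?Q n (f n) (f (Suc n))"
  proof (rule dependent_nat_choice)
    show "\<exists>x. ?P 0 x" using gr van by (intro exI[of _ "(r, d, N)"]) auto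
    fix x :: "nat \<times> (nat \<Rightarrow> int) \<times> (nat \<Rightarrow> ('n, 'a) mpoly) set" and n :: nat
    assume "?P n x"
    moreover obtain r1 d1 N1 where x: "x = (r1, d1, N1)" by (cases x) auto
    ultimately have 1: "graded_sub r1 d1 N1" "\<And>q. \<exists>B. \<forall>j>B. kvanish r1 d1 N1 q j" by auto
    obtain B where "\<And>j. j > B \<Longrightarrow> kvanish r1 d1 N1 0 j" using 1(2) by metis
    then obtain r2 d2 w where mc: "min_cover r1 d1 N1 r2 d2 w"
      using exists_min_cover[OF 1(1)] by blast
    have "graded_sub r2 d2 (fker r2 w)"
      by (rule graded_sub_fker[where r = r1 and d = d1]) (use mc in \<open>auto simp: min_cover_def\<close>)
    moreover have "\<exists>B. \<forall>j>B. kvanish r2 d2 (fker r2 w) q j" for q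
      unfolding kvanish_shift[OF mc] by (rule 1(2))
    ultimately show "\<exists>y. ?P (Suc n) y \<and> ?Q n x y"
      using mc by (intro exI[of _ "(r2, d2, fker r2 w)"]) (auto simp: x)
  qed
  then obtain f where f: "\<forall>n. ?P n (f n) \<and> ?Q n (f n) (f (Suc n))" ..
  have fP: "?P n (f n)" and fQ: "?Q n (f n) (f (Suc n))" for n
    by (rule f[THEN spec, THEN conjunct1]) (rule f[THEN spec, THEN conjunct2])
  define R D M where "R n = fst (f n)" and "D n = fst (snd (f n))" and "M n = snd (snd (f n))" for n
  have f_eq: "f n = (R n, D n, M n)" for n by (simp add: R_def D_def M_def)
  have "\<forall>n. \<exists>w. min_cover (R n) (D n) (M n) (R (Suc n)) (D (Suc n)) w \<and> M (Suc n) = fker (R (Suc n)) w"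
    using fQ unfolding f_eq by simp
  then obtain W where W: "\<And>n. min_cover (R n) (D n) (M n) (R (Suc n)) (D (Suc n)) (W n)"
    "\<And>n. M (Suc n) = fker (R (Suc n)) (W n)" by metis
  have init: "R 0 = r" "D 0 = d" "M 0 = N" using fP[of 0] unfolding f_eq by auto
  have "M n = stage N R W n" for n
    using W(2) init(3) by (cases n) (auto simp: stage_def)
  then have "resolution N R D W" using W(1) by (simp add: resolution_def)
  then show ?thesis using init by blast
qed

text \<open>A set of ring elements, such as an ideal, inside the free module of rank 1.\<close>

definition emb :: "'r::comm_ring_1 set \<Rightarrow> (nat \<Rightarrow> 'r) set" where
  "emb L = {v. v 0 \<in> L \<and> (\<forall>k>0. v k = 0)}"

lemma minimal_resolution_imp_resolution:
  fixes L :: "('n::finite, 'a::field) mpoly set"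
  assumes "minimal_graded_free_resolution (*) L homog_comp r d g w"
  defines "R \<equiv> case_nat 1 r" and "D \<equiv> case_nat (\<lambda>_. 0) d"
    and "W \<equiv> case_nat (\<lambda>k l. if l = 0 then g k else 0) w"
  shows "resolution (emb L) R D W"
proof -
  note C = assms(1)[unfolded minimal_graded_free_resolution_def]
  note C2 = C[THEN conjunct2] note C3 = C2[THEN conjunct2] note C4 = C3[THEN conjunct2]
  note C5 = C4[THEN conjunct2] note C6 = C5[THEN conjunct2]
  have g: "\<And>k. k < r 0 \<Longrightarrow> g k \<in> L \<inter> homog_comp (d 0 k)"
    using C[THEN conjunct1] by simp
  have w: "\<And>i k. k < r (Suc i) \<Longrightarrow> w i k \<in> free_mod (r i)"
    "\<And>i k l. k < r (Suc i) \<Longrightarrow> l < r i \<Longrightarrow> w i k l \<in> homog_comp (d (Suc i) k - d i l)"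
    using C2[THEN conjunct1] by simp_all
  have im: "augmentation (*) (r 0) g ` free_mod (r 0) = L"
    using C3[THEN conjunct1] by simp
  have ex0: "{v \<in> free_mod (r 0). augmentation (*) (r 0) g v = 0} = free_map (r 1) (w 0) ` free_mod (r 1)"
    using C4[THEN conjunct1] by simp
  have ex: "\<And>i. {v \<in> free_mod (r (Suc i)). free_map (r (Suc i)) (w i) v = (\<lambda>_. 0)} =
       free_map (r (Suc (Suc i))) (w (Suc i)) ` free_mod (r (Suc (Suc i)))"
    using C5[THEN conjunct1] by simp
  have m: "\<And>i k l. k < r (Suc i) \<Longrightarrow> l < r i \<Longrightarrow> w i k l \<in> ideal_gen (range Var)"
    using C6 by simp
  have aug: "free_map (r 0) (W 0) v = (\<lambda>l. if l = 0 then augmentation (*) (r 0) g v else 0)" for v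
    by (rule ext) (simp add: W_def free_map_def augmentation_def)
  have ker: "fker (r i) (W i) = free_map (r (Suc i)) (w i) ` free_mod (r (Suc i))" for i
  proof (cases i)
    case 0
    have "fker (r 0) (W 0) = {v \<in> free_mod (r 0). augmentation (*) (r 0) g v = 0}"
      unfolding fker_def aug by (auto simp: fun_eq_iff)
    then show ?thesis using ex0 0 by simp
  next
    case (Suc m)
    then show ?thesis using ex[of m] by (simp add: fker_def W_def zero_fun_def)
  qed
  have stage: "stage (emb L) R W i = free_map (R (Suc i)) (W i) ` free_mod (R (Suc i))" for i
  proof (cases i)
    case 0
    have "free_map (r 0) (W 0) ` free_mod (r 0) = emb L"
    proof (intro equalityI subsetI)
      fix x assume "x \<in> free_map (r 0) (W 0) ` free_mod (r 0)"
      then show "x \<in> emb L" unfolding emb_def im[symmetric] by (auto simp: aug)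
    next
      fix x assume x: "x \<in> emb L"
      then obtain v where v: "v \<in> free_mod (r 0)" "augmentation (*) (r 0) g v = x 0"
        unfolding emb_def im[symmetric] by auto
      have "x = free_map (r 0) (W 0) v"
        using x unfolding aug v(2) by (auto simp: emb_def fun_eq_iff)
      then show "x \<in> free_map (r 0) (W 0) ` free_mod (r 0)" using v(1) by blast
    qed
    then show ?thesis using 0 by (simp add: stage_def R_def)
  next
    case (Suc m)
    then show ?thesis using ker[of m] by (simp add: stage_def R_def W_def)
  qed
  have grd: "W i k \<in> grd (R i) (D i) (D (Suc i) k)" if "k < R (Suc i)" for i k
  proof (cases i)
    case 0
    then show ?thesis using that g by (auto simp: W_def R_def D_def grd_def free_mod_def)
  next
    case (Suc m)
    then show ?thesis using that w by (auto simp: W_def R_def D_def grd_def)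
  qed
  have minimal: "Poly_Mapping.lookup (v l) 0 = 0" if v: "v \<in> fker (R (Suc i)) (W i)" for v i l
  proof -
    have "v \<in> free_map (r (Suc i)) (w i) ` free_mod (r (Suc i))"
      using v ker[of i] by (simp add: R_def)
    then obtain u where u: "v = free_map (r (Suc i)) (w i) u" by blast
    have "v l \<in> ideal_gen (range Var)"
    proof (cases "l < r i")
      case True
      show ?thesis
        unfolding u free_map_def ideal_gen_eq_span
        by (intro imod.span_sum imod.span_scale) (use m True in \<open>simp add: ideal_gen_eq_span\<close>)
    next
      case False
      then have "v l = 0" using v by (simp add: fker_def free_mod_def R_def)
      then show ?thesis by (simp add: ideal_gen_eq_span imod.span_zero)
    qed
    then show ?thesis by (simp add: maximal_ideal_eq)
  qed
  show ?thesis
    unfolding resolution_def min_cover_def using grd stage minimal by blast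
qed

lemma resolution_imp_minimal_resolution:
  fixes L :: "('n::finite, 'a::field) mpoly set"
  assumes res: "resolution (emb L) R D W" and R0: "R 0 = 1" and D0: "D 0 = (\<lambda>_. 0)"
  shows "minimal_graded_free_resolution (*) L homog_comp
    (\<lambda>i. R (Suc i)) (\<lambda>i. D (Suc i)) (\<lambda>k. W 0 k 0) (\<lambda>i. W (Suc i))"
proof -
  have grd: "\<And>i k. k < R (Suc i) \<Longrightarrow> W i k \<in> grd (R i) (D i) (D (Suc i) k)"
    and im: "\<And>i. free_map (R (Suc i)) (W i) ` free_mod (R (Suc i)) = stage (emb L) R W i"
    and minimal: "\<And>i v l. v \<in> fker (R (Suc i)) (W i) \<Longrightarrow> Poly_Mapping.lookup (v l) 0 = 0"
    using res by (auto simp: resolution_def min_cover_def)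
  have W_stage: "W i k \<in> stage (emb L) R W i" if "k < R (Suc i)" for i k
  proof -
    define e :: "nat \<Rightarrow> ('n, 'a) mpoly" where "e l = (if l = k then 1 else 0)" for l
    have "free_map (R (Suc i)) (W i) e = W i k"
      using that by (simp add: fun_eq_iff free_map_def e_def if_distrib[of "\<lambda>x. x * _"] cong: if_cong)
    moreover have "e \<in> free_mod (R (Suc i))" using that by (simp add: free_mod_def e_def)
    ultimately show ?thesis unfolding im[symmetric]
      by (intro image_eqI[where f = "free_map (R (Suc i)) (W i)" and x = e]) simp_all
  qed
  have im0: "free_map (R 1) (W 0) ` free_mod (R 1) = emb L"
    using im[of 0] by (simp add: stage_def)
  have ker: "fker (R (Suc i)) (W i) = free_map (R (Suc (Suc i))) (W (Suc i)) ` free_mod (R (Suc (Suc i)))" for i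
    using im[of "Suc i"] by (simp add: stage_def)
  have W0: "W 0 k l = 0" if "k < R 1" "l > 0" for k l
    using grd[of k 0] that by (auto simp: R0 grd_def free_mod_def)
  have aug: "augmentation (*) (R (Suc 0)) (\<lambda>k. W 0 k 0) v = free_map (R (Suc 0)) (W 0) v 0" for v
    by (simp add: augmentation_def free_map_def)
  have aug0: "free_map (R (Suc 0)) (W 0) v = 0 \<longleftrightarrow> free_map (R (Suc 0)) (W 0) v 0 = 0" for v
  proof
    assume 0: "free_map (R (Suc 0)) (W 0) v 0 = 0"
    have "free_map (R (Suc 0)) (W 0) v l = 0" for l
      using 0 W0 by (cases "l = 0") (auto simp: free_map_def intro!: sum.neutral)
    then show "free_map (R (Suc 0)) (W 0) v = 0" by (simp add: fun_eq_iff)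
  qed simp
  have "augmentation (*) (R (Suc 0)) (\<lambda>k. W 0 k 0) ` free_mod (R (Suc 0)) = (\<lambda>v. v 0) ` emb L"
    unfolding im0[symmetric] image_image aug by simp
  also have "\<dots> = L"
  proof (intro equalityI subsetI)
    fix x assume "x \<in> L"
    then have "(\<lambda>k. if k = 0 then x else 0) \<in> emb L" by (simp add: emb_def)
    then show "x \<in> (\<lambda>v. v 0) ` emb L" by (rule rev_image_eqI) simp
  qed (auto simp: emb_def)
  finally have L: "augmentation (*) (R (Suc 0)) (\<lambda>k. W 0 k 0) ` free_mod (R (Suc 0)) = L" .
  have wm: "W (Suc i) k l \<in> ideal_gen (range Var)" if "k < R (Suc (Suc i))" for i k l
    using minimal[of "W (Suc i) k" i l] W_stage[OF that]
    by (simp add: stage_def maximal_ideal_eq)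
  show ?thesis
    unfolding minimal_graded_free_resolution_def
  proof (intro conjI allI impI)
    fix k assume k: "k < R (Suc 0)"
    have "W 0 k \<in> emb L" using W_stage[OF k] by (simp add: stage_def)
    then have "W 0 k 0 \<in> L" by (simp add: emb_def)
    moreover have "W 0 k 0 \<in> homog_comp (D (Suc 0) k)"
      using grd[OF k] by (simp add: grd_def R0 D0)
    ultimately show "W 0 k 0 \<in> L \<inter> homog_comp (D (Suc 0) k)" by blast
  next
    show "{v \<in> free_mod (R (Suc 0)). augmentation (*) (R (Suc 0)) (\<lambda>k. W 0 k 0) v = 0} =
      free_map (R (Suc 1)) (W (Suc 0)) ` free_mod (R (Suc 1))"
      using ker[of 0] aug0 by (simp add: aug fker_def)
  next
    fix i
    show "{v \<in> free_mod (R (Suc (Suc i))). free_map (R (Suc (Suc i))) (W (Suc i)) v = (\<lambda>_. 0)} =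
      free_map (R (Suc (Suc (Suc i)))) (W (Suc (Suc i))) ` free_mod (R (Suc (Suc (Suc i))))"
      using ker[of "Suc i"] by (simp add: fker_def zero_fun_def)
  qed (use grd wm L in \<open>auto simp: grd_def\<close>)
qed

text \<open>
  Betti numbers are read off Koszul homology. Vanishing in large degrees is what makes the
  syzygy modules finitely generated, so that minimal resolutions exist.
\<close>

lemma betti_nonzero_iff:
  fixes L :: "('n::{finite,linorder}, 'a::field) mpoly set"
  assumes gr: "graded_sub 1 (\<lambda>_. 0) (emb L)"
    and van: "\<And>q. \<exists>B. \<forall>j>B. kvanish 1 (\<lambda>_. 0) (emb L) q j"
  shows "betti (*) L homog_comp i j \<noteq> 0 \<longleftrightarrow> \<not> kvanish 1 (\<lambda>_. 0) (emb L) i j"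
proof -
  let ?P = "\<lambda>b. \<exists>r d g w. minimal_graded_free_resolution (*) L homog_comp r d g w \<and>
    b = card {k. k < r i \<and> d i k = j}"
  obtain R D W where "R 0 = 1" "D 0 = (\<lambda>_. 0)" "resolution (emb L) R D W"
    using exists_resolution[OF gr van] by blast
  then have "\<exists>b. ?P b" using resolution_imp_minimal_resolution by blast
  then have "?P (betti (*) L homog_comp i j)"
    unfolding betti_def by (rule someI_ex)
  then obtain r d g w where res: "minimal_graded_free_resolution (*) L homog_comp r d g w"
    and b: "betti (*) L homog_comp i j = card {k. k < r i \<and> d i k = j}" by blast
  have "betti (*) L homog_comp i j \<noteq> 0 \<longleftrightarrow> (\<exists>k<r i. d i k = j)"
    unfolding b by (auto simp: card_eq_0_iff)
  then show ?thesis
    using resolution_degrees[OF minimal_resolution_imp_resolution[OF res], of i j] by simp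
qed

section \<open>Monomial ideals\<close>

text \<open>The exponent vectors of the monomials in a set of polynomials.\<close>

definition exps :: "('n, 'a::comm_ring_1) mpoly set \<Rightarrow> ('n \<Rightarrow>\<^sub>0 nat) set" where
  "exps I = {t. monomial t \<in> I}"

text \<open>
  The polynomials whose monomials all have exponents in \<open>E\<close>; this is an ideal if \<open>E\<close> is closed
  under adding exponent vectors.
\<close>

definition mon_ideal :: "('n \<Rightarrow>\<^sub>0 nat) set \<Rightarrow> ('n, 'a::comm_ring_1) mpoly set" where
  "mon_ideal E = {f. Poly_Mapping.keys f \<subseteq> E}"

text \<open>Closed under adding arbitrary exponent vectors, as the exponents of a monomial ideal are.\<close>

definition up_closed :: "('n \<Rightarrow>\<^sub>0 nat) set \<Rightarrow> bool" where
  "up_closed E \<longleftrightarrow> (\<forall>s\<in>E. \<forall>t. s + t \<in> E)"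

lemma up_closedD: "up_closed E \<Longrightarrow> s \<in> E \<Longrightarrow> s + t \<in> E"
  by (simp add: up_closed_def)

lemma mon_ideal_subspace:
  assumes "up_closed E"
  shows "imod.subspace (mon_ideal E :: ('n, 'a::comm_ring_1) mpoly set)"
proof (rule imod.subspaceI)
  show "x + y \<in> mon_ideal E" if "x \<in> mon_ideal E" "y \<in> mon_ideal E" for x y :: "('n, 'a) mpoly"
    using that keys_add[of x y] unfolding mon_ideal_def by blast
  show "c * x \<in> mon_ideal E" if "x \<in> mon_ideal E" for c x :: "('n, 'a) mpoly"
  proof -
    have "k \<in> E" if "k \<in> Poly_Mapping.keys (c * x)" for k
    proof -
      obtain a b where "k = a + b" "b \<in> Poly_Mapping.keys x"
        using keys_mult[of c x] \<open>k \<in> Poly_Mapping.keys (c * x)\<close> by blast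
      then show ?thesis
        using \<open>x \<in> mon_ideal E\<close> up_closedD[OF assms, of b a] by (auto simp: mon_ideal_def add.commute)
    qed
    then show ?thesis by (auto simp: mon_ideal_def)
  qed
qed (simp add: mon_ideal_def)

lemma single_eq_times_monomial: "Poly_Mapping.single t c = Poly_Mapping.single 0 c * monomial t"
  by (simp add: monomial_def mult_single)

lemma monomial_add: "monomial (s + t) = monomial s * monomial t"
  by (simp add: monomial_def mult_single)

lemma mon_ideal_subset:
  fixes I :: "('n, 'a::comm_ring_1) mpoly set"
  assumes "imod.subspace I" "\<And>t. t \<in> E \<Longrightarrow> monomial t \<in> I"
  shows "mon_ideal E \<subseteq> I"
proof
  fix f :: "('n, 'a) mpoly"
  assume f: "f \<in> mon_ideal E"
  have "(\<Sum>t\<in>Poly_Mapping.keys f. Poly_Mapping.single t (Poly_Mapping.lookup f t)) \<in> I"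
  proof (rule imod.subspace_sum[OF assms(1)])
    fix t assume "t \<in> Poly_Mapping.keys f"
    then have "monomial t \<in> I" using f assms(2) by (auto simp: mon_ideal_def)
    then show "Poly_Mapping.single t (Poly_Mapping.lookup f t) \<in> I"
      by (subst single_eq_times_monomial) (rule imod.subspace_scale[OF assms(1)])
  qed
  then show "f \<in> I" using poly_mapping_sum_single[of f] by simp
qed

lemma exps_mon_ideal: "exps (mon_ideal E :: ('n, 'a::comm_ring_1) mpoly set) = E"
  by (auto simp: exps_def mon_ideal_def monomial_def)

lemma monomial_ideal_up_closed:
  fixes I :: "('n, 'a::comm_ring_1) mpoly set"
  assumes "monomial_ideal I"
  shows "up_closed (exps I)"
proof -
  obtain G where "I = imod.span (monomial ` G)"
    using assms by (auto simp: monomial_ideal_def ideal_gen_eq_span)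
  then have sub: "imod.subspace I" by simp
  have "monomial (s + t) \<in> I" if "monomial s \<in> I" for s t
    using imod.subspace_scale[OF sub that, of "monomial t"] by (simp add: monomial_add mult.commute)
  then show ?thesis by (simp add: up_closed_def exps_def)
qed

lemma monomial_ideal_eq_mon_ideal:
  fixes I :: "('n, 'a::comm_ring_1) mpoly set"
  assumes "monomial_ideal I"
  shows "I = mon_ideal (exps I)"
proof
  obtain G where I: "I = imod.span (monomial ` G)"
    using assms by (auto simp: monomial_ideal_def ideal_gen_eq_span)
  have "monomial ` G \<subseteq> mon_ideal (exps I)"
    using imod.span_superset[of "monomial ` G"] unfolding I
    by (auto simp: mon_ideal_def exps_def monomial_def)
  then show "I \<subseteq> mon_ideal (exps I)"
    using imod.span_minimal mon_ideal_subspace[OF monomial_ideal_up_closed[OF assms]] I by metis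
  show "mon_ideal (exps I) \<subseteq> I"
    by (rule mon_ideal_subset) (simp_all add: I exps_def)
qed

text \<open>The Minkowski sum; on exponents it describes the product of monomial ideals.\<close>

definition sum_set :: "('n \<Rightarrow>\<^sub>0 nat) set \<Rightarrow> ('n \<Rightarrow>\<^sub>0 nat) set \<Rightarrow> ('n \<Rightarrow>\<^sub>0 nat) set" where
  "sum_set E F = {a + b | a b. a \<in> E \<and> b \<in> F}"

lemma up_closed_sum_set: "up_closed E \<Longrightarrow> up_closed (sum_set E F)"
  unfolding up_closed_def sum_set_def
proof clarify
  fix t a b assume *: "\<forall>s\<in>E. \<forall>t. s + t \<in> E" "a \<in> E" "b \<in> F"
  have "a + b + t = (a + t) + b" by (simp add: add_ac)
  then show "\<exists>a' b'. a + b + t = a' + b' \<and> a' \<in> E \<and> b' \<in> F" using * by blast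
qed

lemma ideal_prod_times: "f \<in> I \<Longrightarrow> g \<in> J \<Longrightarrow> f * g \<in> ideal_prod I J"
  unfolding ideal_prod_def ideal_gen_eq_span by (rule imod.span_base) blast

lemma ideal_prod_subset:
  assumes "imod.subspace L" "\<And>f g. f \<in> I \<Longrightarrow> g \<in> J \<Longrightarrow> f * g \<in> L"
  shows "ideal_prod I J \<subseteq> L"
  unfolding ideal_prod_def ideal_gen_eq_span by (rule imod.span_minimal) (use assms in auto)

lemma ideal_prod_mon_ideal:
  assumes "up_closed E"
  shows "ideal_prod (mon_ideal E) (mon_ideal F) = (mon_ideal (sum_set E F) :: ('n, 'a::comm_ring_1) mpoly set)"
proof
  have "f * g \<in> mon_ideal (sum_set E F)" if "f \<in> mon_ideal E" "g \<in> mon_ideal F" for f g :: "('n, 'a) mpoly"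
    using that keys_mult[of f g] unfolding mon_ideal_def sum_set_def by blast
  then show "ideal_prod (mon_ideal E) (mon_ideal F) \<subseteq> (mon_ideal (sum_set E F) :: ('n, 'a) mpoly set)"
    by (intro ideal_prod_subset mon_ideal_subspace up_closed_sum_set assms)
  have sub: "imod.subspace (ideal_prod (mon_ideal E) (mon_ideal F) :: ('n, 'a) mpoly set)"
    unfolding ideal_prod_def ideal_gen_eq_span by simp
  show "(mon_ideal (sum_set E F) :: ('n, 'a) mpoly set) \<subseteq> ideal_prod (mon_ideal E) (mon_ideal F)"
  proof (rule mon_ideal_subset[OF sub])
    fix t assume "t \<in> sum_set E F"
    then obtain a b where t: "t = a + b" "a \<in> E" "b \<in> F" by (auto simp: sum_set_def)
    have "monomial a \<in> (mon_ideal E :: ('n, 'a) mpoly set)" "monomial b \<in> (mon_ideal F :: ('n, 'a) mpoly set)"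
      using t by (auto simp: mon_ideal_def monomial_def)
    then show "(monomial t :: ('n, 'a) mpoly) \<in> ideal_prod (mon_ideal E) (mon_ideal F)"
      unfolding t monomial_add by (rule ideal_prod_times)
  qed
qed

text \<open>
  For \<open>E\<close> the exponents of a monomial ideal, this says that every monomial of the ideal of
  degree above \<open>\<rho>\<close>, other than the monomial 1, stays in the ideal when divided by its last variable.
\<close>

definition last_reducible :: "real \<Rightarrow> ('n::linorder \<Rightarrow>\<^sub>0 nat) set \<Rightarrow> bool" where
  "last_reducible \<rho> E \<longleftrightarrow> (\<forall>v\<in>E. v \<noteq> 0 \<and> real (mon_degree v) > \<rho> \<longrightarrow>
     v - Poly_Mapping.single (Max (Poly_Mapping.keys v)) 1 \<in> E)"

lemma sum_set_commute: "sum_set E F = sum_set F E"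
proof -
  have "sum_set E F \<subseteq> sum_set F E" for E F :: "('a \<Rightarrow>\<^sub>0 nat) set"
  proof
    fix t assume "t \<in> sum_set E F"
    then obtain a b where "t = b + a" "a \<in> E" "b \<in> F" unfolding sum_set_def by (auto simp: add.commute)
    then show "t \<in> sum_set F E" unfolding sum_set_def by blast
  qed
  then show ?thesis by blast
qed

lemma Max_keys_pos:
  fixes v :: "'n::linorder \<Rightarrow>\<^sub>0 nat"
  assumes "v \<noteq> 0"
  shows "0 < Poly_Mapping.lookup v (Max (Poly_Mapping.keys v))"
proof -
  have "Poly_Mapping.keys v \<noteq> {}" using assms by simp
  then have "Max (Poly_Mapping.keys v) \<in> Poly_Mapping.keys v" by (intro Max_in) auto
  then show ?thesis by (simp add: in_keys_iff)
qed

text \<open>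
  Variables are moved from the first factor to the second until the first one has degree at
  most \<open>e\<close>; then the second one has degree above \<open>f\<close> and still contains the last variable.
\<close>

lemma last_reducible_sum_aux:
  fixes E F :: "('n::{finite,linorder} \<Rightarrow>\<^sub>0 nat) set"
  assumes E: "last_reducible e E" "e \<ge> 0" and F: "last_reducible f F" "up_closed F"
    and "a \<in> E" "b \<in> F" "real (mon_degree (a + b)) > e + f"
    and "Max (Poly_Mapping.keys (a + b)) \<in> Poly_Mapping.keys b"
  shows "a + b - Poly_Mapping.single (Max (Poly_Mapping.keys (a + b))) 1 \<in> sum_set E F"
  using assms(5-8)
proof (induction "mon_degree a" arbitrary: a b rule: less_induct)
  case less
  let ?x = "\<lambda>i. Poly_Mapping.single i (1::nat)"
  let ?i = "Max (Poly_Mapping.keys (a + b))"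
  have keys: "Poly_Mapping.keys (a + b) = Poly_Mapping.keys a \<union> Poly_Mapping.keys b"
    by (auto simp: in_keys_iff lookup_add)
  show ?case
  proof (cases "real (mon_degree a) > e")
    case True
    let ?m = "Max (Poly_Mapping.keys a)"
    have a0: "a \<noteq> 0" using True E(2) by auto
    have a': "a - ?x ?m \<in> E"
      using E(1) less.prems(1) a0 True unfolding last_reducible_def by blast
    have eq: "a = ?x ?m + (a - ?x ?m)"
      by (rule exponent_split[OF Max_keys_pos[OF a0]])
    have sum: "(a - ?x ?m) + (b + ?x ?m) = a + b"
      using eq by (metis add.assoc add.commute)
    have "mon_degree a = 1 + mon_degree (a - ?x ?m)"
      using arg_cong[OF eq, of mon_degree] by (simp add: mon_degree_add)
    moreover have "b + ?x ?m \<in> F"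
      by (rule up_closedD[OF F(2) less.prems(2)])
    moreover have "?i \<in> Poly_Mapping.keys (b + ?x ?m)"
      using less.prems(4) by (simp add: in_keys_iff lookup_add)
    ultimately have "(a - ?x ?m) + (b + ?x ?m) - ?x (Max (Poly_Mapping.keys ((a - ?x ?m) + (b + ?x ?m))))
        \<in> sum_set E F"
      using a' less.prems(3) by (intro less.hyps) (simp_all only: sum)
    then show ?thesis by (simp only: sum)
  next
    case False
    then have degb: "real (mon_degree b) > f" using less.prems(3) by (simp add: mon_degree_add)
    have "Max (Poly_Mapping.keys b) = ?i"
      using less.prems(4) by (intro Max_eqI) (auto simp: keys)
    then have b': "b - ?x ?i \<in> F"
      using F(1) less.prems(2,4) degb unfolding last_reducible_def by (metis empty_iff keys_zero)
    have "b = ?x ?i + (b - ?x ?i)"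
      by (rule exponent_split) (use less.prems(4) in \<open>simp add: in_keys_iff\<close>)
    then have "a + b = ?x ?i + (a + (b - ?x ?i))"
      by (metis add.left_commute)
    then have "a + b - ?x ?i = a + (b - ?x ?i)"
      by (metis add_diff_cancel_left')
    then show ?thesis using b' less.prems(1) unfolding sum_set_def by blast
  qed
qed

lemma last_reducible_sum_set:
  fixes E F :: "('n::{finite,linorder} \<Rightarrow>\<^sub>0 nat) set"
  assumes E: "last_reducible e E" "up_closed E" "e \<ge> 0" and F: "last_reducible f F" "up_closed F" "f \<ge> 0"
  shows "last_reducible (e + f) (sum_set E F)"
  unfolding last_reducible_def
proof (intro ballI impI)
  fix v assume v: "v \<in> sum_set E F" "v \<noteq> 0 \<and> real (mon_degree v) > e + f"
  then obtain a b where ab: "v = a + b" "a \<in> E" "b \<in> F" by (auto simp: sum_set_def)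
  have "Max (Poly_Mapping.keys v) \<in> Poly_Mapping.keys v"
    using v(2) by (intro Max_in) auto
  then have "Max (Poly_Mapping.keys v) \<in> Poly_Mapping.keys a \<or> Max (Poly_Mapping.keys v) \<in> Poly_Mapping.keys b"
    by (auto simp: ab(1) in_keys_iff lookup_add)
  then show "v - Poly_Mapping.single (Max (Poly_Mapping.keys v)) 1 \<in> sum_set E F"
  proof
    assume "Max (Poly_Mapping.keys v) \<in> Poly_Mapping.keys b"
    then show ?thesis
      using last_reducible_sum_aux[OF E(1,3) F(1,2) ab(2,3)] v(2) by (simp add: ab(1))
  next
    assume "Max (Poly_Mapping.keys v) \<in> Poly_Mapping.keys a"
    then show ?thesis
      using last_reducible_sum_aux[OF F(1,3) E(1,2) ab(3,2)] v(2)
      by (simp add: ab(1) add.commute sum_set_commute[of E F])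
  qed
qed

section \<open>Koszul homology of monomial ideals\<close>

lemma graded_sub_emb:
  fixes E :: "('n \<Rightarrow>\<^sub>0 nat) set"
  assumes "up_closed E"
  shows "graded_sub 1 (\<lambda>_. 0) (emb (mon_ideal E :: ('n, 'a::comm_ring_1) mpoly set))"
  unfolding graded_sub_def
proof (intro conjI ballI allI)
  note sub = mon_ideal_subspace[OF assms, where ?'a = 'a]
  show "vmod.subspace (emb (mon_ideal E :: ('n, 'a) mpoly set))"
  proof (rule vmod.subspaceI)
    show "0 \<in> emb (mon_ideal E :: ('n, 'a) mpoly set)"
      using imod.subspace_0[OF sub] by (simp add: emb_def)
    show "x + y \<in> emb (mon_ideal E)" if "x \<in> emb (mon_ideal E)" "y \<in> emb (mon_ideal E)"
      for x y :: "nat \<Rightarrow> ('n, 'a) mpoly"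
      using that imod.subspace_add[OF sub] by (auto simp: emb_def)
    show "vscale c x \<in> emb (mon_ideal E)" if "x \<in> emb (mon_ideal E)"
      for c and x :: "nat \<Rightarrow> ('n, 'a) mpoly"
      using that imod.subspace_scale[OF sub] by (auto simp: emb_def vscale_apply)
  qed
  show "emb (mon_ideal E :: ('n, 'a) mpoly set) \<subseteq> free_mod 1"
    by (auto simp: emb_def free_mod_def)
  fix v :: "nat \<Rightarrow> ('n, 'a) mpoly" and j
  assume v: "v \<in> emb (mon_ideal E)"
  then have "Poly_Mapping.keys (hcomp j (v 0)) \<subseteq> E"
    by (auto simp: emb_def mon_ideal_def in_keys_iff lookup_hcomp when_def split: if_splits)
  then show "hpart 1 (\<lambda>_. 0) j v \<in> emb (mon_ideal E)"
    by (simp add: emb_def hpart_def mon_ideal_def)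
qed

lemma emb_subset: "emb L \<subseteq> free_mod 1"
  by (auto simp: emb_def free_mod_def)

text \<open>
  The coefficients of a cycle in internal degree \<open>j\<close> and homological degree \<open>q\<close> have degree \<open>j - q\<close>,
  and a monomial of the cone arises from a monomial of the cycle by division by the apex, which is
  the last variable of that monomial. So the cone has coefficients in the ideal.
\<close>

lemma kvanish_mon_ideal:
  fixes E :: "('n::{finite,linorder} \<Rightarrow>\<^sub>0 nat) set"
  assumes red: "last_reducible \<rho> E" and "\<rho> \<ge> 0" and j: "real_of_int (j - int q) > \<rho>"
  shows "kvanish 1 (\<lambda>_. 0) (emb (mon_ideal E :: ('n, 'a::comm_ring_1) mpoly set)) q j"
  unfolding kvanish_def
proof (intro ballI impI)
  fix c :: "'n set \<Rightarrow> nat \<Rightarrow> ('n, 'a) mpoly"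
  assume c: "c \<in> kchains 1 (\<lambda>_. 0) (emb (mon_ideal E)) q j" and cyc: "kosz c = 0"
  have cF: "c \<in> kchains 1 (\<lambda>_. 0) (free_mod 1) q j"
    using kchains_mono[OF emb_subset] c by blast
  have deg: "card T = q \<and> t \<in> E \<and> int (mon_degree t) = j - int q"
    if "Poly_Mapping.lookup (c T 0) t \<noteq> 0" for T t
  proof -
    have q: "card T = q"
    proof (rule ccontr)
      assume "card T \<noteq> q"
      then have "c T = 0" by (rule kchainsD(3)[OF c])
      then show False using that by simp
    qed
    have "c T \<in> emb (mon_ideal E)" "c T \<in> grd 1 (\<lambda>_. 0) (j - int q)"
      using kchainsD(1,2)[OF c q] by auto
    then have "Poly_Mapping.keys (c T 0) \<subseteq> E" "c T 0 \<in> homog_comp (j - int q)"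
      by (auto simp: emb_def mon_ideal_def grd_def)
    then show ?thesis using that q by (auto simp: homog_comp_iff in_keys_iff)
  qed
  have c0: "Poly_Mapping.lookup (c {} k) 0 = 0" for k
  proof (cases "k = 0")
    case True
    show ?thesis
    proof (rule ccontr)
      assume "Poly_Mapping.lookup (c {} k) 0 \<noteq> 0"
      then have "int (mon_degree (0 :: 'n \<Rightarrow>\<^sub>0 nat)) = j - int q" using deg True by blast
      then show False using j assms(2) by simp
    qed
  next
    case False
    have "c {} \<in> free_mod 1" by (rule kchains_in[OF subspace_free_mod cF])
    then show ?thesis using False by (simp add: free_mod_def)
  qed
  have kF: "kcone c \<in> kchains 1 (\<lambda>_. 0) (free_mod 1) (Suc q) j"
    by (rule kcone_in_kchains[OF cF])
  have kE: "t \<in> E" if nz: "Poly_Mapping.lookup (kcone c T 0) t \<noteq> 0" for T t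
  proof -
    let ?i = "apex T t"
    have i: "?i \<in> T" and L: "Poly_Mapping.lookup (c (T - {?i}) 0) (t + Poly_Mapping.single ?i 1) \<noteq> 0"
      using nz unfolding lookup_kcone by (auto split: if_splits)
    let ?v = "t + Poly_Mapping.single ?i 1"
    have v: "?v \<in> E" "int (mon_degree ?v) = j - int q" using deg[OF L] by auto
    have keys: "Poly_Mapping.keys ?v = insert ?i (Poly_Mapping.keys t)"
      by (auto simp: in_keys_iff lookup_add lookup_single when_def split: if_splits)
    have "Max (Poly_Mapping.keys ?v) = ?i"
      unfolding keys by (intro Max_eqI) (auto simp: apex_def)
    moreover have "?v \<noteq> 0" using keys by (metis empty_not_insert keys_zero)
    moreover have "real (mon_degree ?v) > \<rho>"
      using v(2) j by (metis of_int_of_nat_eq)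
    ultimately have "?v - Poly_Mapping.single ?i 1 \<in> E"
      using red v(1) unfolding last_reducible_def by metis
    then show ?thesis by simp
  qed
  have "kcone c \<in> kchains 1 (\<lambda>_. 0) (emb (mon_ideal E)) (Suc q) j"
    unfolding kchains_def
  proof clarify
    fix T :: "'n set"
    have "kcone c T \<in> free_mod 1" by (rule kchains_in[OF subspace_free_mod kF])
    moreover have "Poly_Mapping.keys (kcone c T 0) \<subseteq> E" using kE by (auto simp: in_keys_iff)
    ultimately have "kcone c T \<in> emb (mon_ideal E)"
      by (simp add: emb_def mon_ideal_def free_mod_def)
    then show "if card T = Suc q
      then kcone c T \<in> emb (mon_ideal E) \<inter> grd 1 (\<lambda>_. 0) (j - int (Suc q)) else kcone c T = 0"
      using kchainsD(2,3)[OF kF, of T] by simp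
  qed
  moreover have "kosz (kcone c) = c"
    by (intro ext kosz_kcone[OF cyc c0])
  ultimately show "\<exists>b\<in>kchains 1 (\<lambda>_. 0) (emb (mon_ideal E)) (Suc q) j. kosz b = c" by blast
qed

text \<open>
  Let \<open>z\<close> be a monomial in the variables up to \<open>i\<close> that is outside the ideal while its products with
  these variables are inside. The boundary of \<open>z\<close> times the exterior product of these variables has
  coefficients in the ideal. If it were the boundary of a chain \<open>b\<close> with coefficients in the ideal,
  then \<open>z\<close> would have to occur in \<open>b\<close>, because the complex over the ring itself is exact.
\<close>

lemma not_kvanish_mon_ideal:
  fixes E :: "('n::{finite,linorder} \<Rightarrow>\<^sub>0 nat) set"
  assumes "z \<notin> E" and zl: "\<And>l. l \<le> i \<Longrightarrow> z + Poly_Mapping.single l 1 \<in> E"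
    and supp: "\<And>l. l > i \<Longrightarrow> Poly_Mapping.lookup z l = 0"
  shows "\<not> kvanish 1 (\<lambda>_. 0) (emb (mon_ideal E :: ('n, 'a::comm_ring_1) mpoly set))
    (card {..i} - 1) (int (mon_degree z + card {..i}))"
proof
  let ?q = "card {..i} - 1" and ?j = "int (mon_degree z + card {..i})"
  let ?d = "\<lambda>_ :: nat. 0 :: int"
  assume van: "kvanish 1 ?d (emb (mon_ideal E :: ('n, 'a) mpoly set)) ?q ?j"
  have "{..i} \<noteq> {}" by auto
  then have card: "card {..i} = Suc ?q" by (simp add: card_gt_0_iff)
  define y :: "'n set \<Rightarrow> nat \<Rightarrow> ('n, 'a) mpoly" where
    "y T k = (if T = {..i} \<and> k = 0 then monomial z else 0)" for T k
  have yF: "y \<in> kchains 1 ?d (free_mod 1) (Suc ?q) ?j"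
    unfolding kchains_def
  proof clarify
    fix T :: "'n set"
    have "y T \<in> grd 1 ?d (?j - int (Suc ?q))"
      using card by (auto simp: grd_def free_mod_def y_def monomial_def homog_comp_def)
    moreover have "y T = 0" if "card T \<noteq> Suc ?q"
      using that card by (auto simp: y_def fun_eq_iff)
    ultimately show "if card T = Suc ?q then y T \<in> free_mod 1 \<inter> grd 1 ?d (?j - int (Suc ?q)) else y T = 0"
      using grd_subset by auto
  qed
  have kyF: "kosz y \<in> kchains 1 ?d (free_mod 1) ?q ?j"
    by (rule kosz_in_kchains[OF subspace_free_mod yF])
  have kyE: "t \<in> E" if nz: "Poly_Mapping.lookup (kosz y T 0) t \<noteq> 0" for T t
  proof -
    obtain l where l: "l \<in> - T" "(-1) ^ card {x\<in>T. x < l} *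
      (if 0 < Poly_Mapping.lookup t l
       then Poly_Mapping.lookup (y (insert l T) 0) (t - Poly_Mapping.single l 1) else 0) \<noteq> 0"
      using sum.not_neutral_contains_not_neutral[OF nz[unfolded lookup_kosz]] by blast
    have pos: "0 < Poly_Mapping.lookup t l"
      using l(2) by (cases "0 < Poly_Mapping.lookup t l") simp_all
    have nzl: "Poly_Mapping.lookup (y (insert l T) 0) (t - Poly_Mapping.single l 1) \<noteq> 0"
      using l(2) pos by auto
    have "insert l T = {..i}" "t - Poly_Mapping.single l 1 = z"
      using nzl by (auto simp: y_def monomial_def lookup_single when_def split: if_splits)
    then show ?thesis using zl[of l] exponent_split[OF pos] by (auto simp: add.commute)
  qed
  have "kosz y \<in> kchains 1 ?d (emb (mon_ideal E)) ?q ?j"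
    unfolding kchains_def
  proof clarify
    fix T :: "'n set"
    have "kosz y T \<in> free_mod 1" by (rule kchains_in[OF subspace_free_mod kyF])
    moreover have "Poly_Mapping.keys (kosz y T 0) \<subseteq> E" using kyE by (auto simp: in_keys_iff)
    ultimately have "kosz y T \<in> emb (mon_ideal E)"
      by (simp add: emb_def mon_ideal_def free_mod_def)
    then show "if card T = ?q
      then kosz y T \<in> emb (mon_ideal E) \<inter> grd 1 ?d (?j - int ?q) else kosz y T = 0"
      using kchainsD(2,3)[OF kyF, of T] by simp
  qed
  then obtain b where b: "b \<in> kchains 1 ?d (emb (mon_ideal E)) (Suc ?q) ?j" "kosz b = kosz y"
    using van kosz_kosz[of y] unfolding kvanish_def by blast
  have bF: "b \<in> kchains 1 ?d (free_mod 1) (Suc ?q) ?j"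
    using kchains_mono[OF emb_subset] b(1) by blast
  let ?g = "\<lambda>T. b T - y T"
  have g: "?g \<in> kchains 1 ?d (free_mod 1) (Suc ?q) ?j"
    by (rule kchains_diff[OF subspace_free_mod bF yF])
  have gcyc: "kosz ?g = 0" by (simp add: kosz_diff b(2))
  have "?g {} = 0" by (rule kchainsD(3)[OF g]) simp
  then have "Poly_Mapping.lookup (?g {} k) 0 = 0" for k by (simp add: fun_eq_iff)
  then obtain h where h: "kosz h = ?g"
    using kosz_exact_free[OF g gcyc] by blast
  \<comment> \<open>The boundary at \<open>{..i}\<close> only involves multiples of variables after \<open>i\<close>, and \<open>z\<close> is not divisible
    by any of them.\<close>
  have "Poly_Mapping.lookup (kosz h {..i} 0) z = 0"
    unfolding lookup_kosz using supp by (intro sum.neutral) auto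
  then have "Poly_Mapping.lookup (b {..i} 0) z = Poly_Mapping.lookup (y {..i} 0) z"
    unfolding h by (simp add: lookup_minus)
  also have "\<dots> = 1" by (simp add: y_def monomial_def)
  finally have "z \<in> Poly_Mapping.keys (b {..i} 0)" by (simp add: in_keys_iff)
  moreover have "b {..i} \<in> emb (mon_ideal E)"
    by (rule kchainsD(1)[OF b(1) card])
  ultimately show False using assms(1) by (auto simp: emb_def mon_ideal_def)
qed

text \<open>A monomial of least degree in the ideal is a minimal generator.\<close>

lemma not_kvanish_0_mon_ideal:
  fixes E :: "('n::{finite,linorder} \<Rightarrow>\<^sub>0 nat) set"
  assumes "E \<noteq> {}"
  shows "\<exists>m. \<not> kvanish 1 (\<lambda>_. 0) (emb (mon_ideal E :: ('n, 'a::comm_ring_1) mpoly set)) 0 (int m)"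
proof -
  obtain z where z: "z \<in> E" and least: "\<And>t. t \<in> E \<Longrightarrow> mon_degree z \<le> mon_degree t"
    using assms ex_has_least_nat[of "\<lambda>t. t \<in> E" _ mon_degree] by blast
  let ?d = "\<lambda>_ :: nat. 0 :: int" and ?N = "emb (mon_ideal E :: ('n, 'a) mpoly set)"
  define c :: "'n set \<Rightarrow> nat \<Rightarrow> ('n, 'a) mpoly" where
    "c T k = (if T = {} \<and> k = 0 then monomial z else 0)" for T k
  have c: "c \<in> kchains 1 ?d ?N 0 (int (mon_degree z))"
    unfolding kchains_def
  proof clarify
    fix T :: "'n set"
    show "if card T = 0 then c T \<in> ?N \<inter> grd 1 ?d (int (mon_degree z) - int 0) else c T = 0"
      using z by (auto simp: c_def fun_eq_iff card_eq_0_iff emb_def mon_ideal_def grd_def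
          free_mod_def monomial_def homog_comp_def)
  qed
  have "\<not> kvanish 1 ?d ?N 0 (int (mon_degree z))"
  proof
    assume "kvanish 1 ?d ?N 0 (int (mon_degree z))"
    then obtain b where b: "b \<in> kchains 1 ?d ?N (Suc 0) (int (mon_degree z))" "kosz b = c"
      using c kosz_kchains_0[OF c] unfolding kvanish_def by blast
    have "b T 0 = 0" for T
    proof (rule ccontr)
      assume "b T 0 \<noteq> 0"
      then obtain t where t: "t \<in> Poly_Mapping.keys (b T 0)"
        by (metis all_not_in_conv keys_eq_empty)
      have T: "card T = Suc 0"
      proof (rule ccontr)
        assume "card T \<noteq> Suc 0"
        then have "b T = 0" by (rule kchainsD(3)[OF b(1)])
        then show False using \<open>b T 0 \<noteq> 0\<close> by simp
      qed
      have "t \<in> E" "int (mon_degree t) = int (mon_degree z) - 1"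
        using kchainsD(1,2)[OF b(1) T] t by (auto simp: emb_def mon_ideal_def grd_def homog_comp_def)
      then show False using least[of t] by simp
    qed
    then have "kosz b {} 0 = 0" by (simp add: kosz_def)
    then have "(monomial z :: ('n, 'a) mpoly) = 0" by (simp add: b(2) c_def)
    then have "Poly_Mapping.lookup (monomial z :: ('n, 'a) mpoly) z = 0" by simp
    then show False by (simp add: monomial_def)
  qed
  then show ?thesis by blast
qed

section \<open>Ideals of Borel type\<close>

lemma nat_sequence_nondecreasing_subsequence:
  fixes s :: "nat \<Rightarrow> nat"
  shows "\<exists>\<phi> :: nat \<Rightarrow> nat. strict_mono \<phi> \<and> mono (\<lambda>n. s (\<phi> n))"
proof -
  obtain \<phi> :: "nat \<Rightarrow> nat" where \<phi>: "strict_mono \<phi>" "monoseq (\<lambda>n. s (\<phi> n))"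
    using seq_monosub[of s] by blast
  show ?thesis
  proof (cases "mono (\<lambda>n. s (\<phi> n))")
    case True
    then show ?thesis using \<phi>(1) by blast
  next
    case False
    then have dec: "s (\<phi> n) \<le> s (\<phi> m)" if "m \<le> n" for m n
      using \<phi>(2) that by (auto simp: monoseq_def mono_def)
    obtain k where k: "\<And>n. s (\<phi> k) \<le> s (\<phi> n)"
      using ex_has_least_nat[of "\<lambda>_. True" 0 "\<lambda>n. s (\<phi> n)"] by auto
    have "s (\<phi> (k + n)) = s (\<phi> k)" for n
      using k[of "k + n"] dec[of k "k + n"] by simp
    then have "mono (\<lambda>n. s (\<phi> (k + n)))" by (simp add: mono_def)
    moreover have "strict_mono (\<lambda>n. \<phi> (k + n))"
      using \<phi>(1) by (auto simp: strict_mono_def)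
    ultimately show ?thesis by blast
  qed
qed

lemma coordinatewise_nondecreasing_subsequence:
  fixes f :: "nat \<Rightarrow> 'b \<Rightarrow> nat"
  assumes "finite A"
  shows "\<exists>\<phi> :: nat \<Rightarrow> nat. strict_mono \<phi> \<and> (\<forall>i\<in>A. mono (\<lambda>n. f (\<phi> n) i))"
  using assms
proof (induction A rule: finite_induct)
  case empty
  have "strict_mono (\<lambda>n :: nat. n)" by (simp add: strict_mono_def)
  then show ?case by blast
next
  case (insert a A)
  then obtain \<phi> :: "nat \<Rightarrow> nat" where \<phi>: "strict_mono \<phi>" "\<forall>i\<in>A. mono (\<lambda>n. f (\<phi> n) i)" by blast
  obtain \<psi> :: "nat \<Rightarrow> nat" where \<psi>: "strict_mono \<psi>" "mono (\<lambda>n. f (\<phi> (\<psi> n)) a)"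
    using nat_sequence_nondecreasing_subsequence[of "\<lambda>n. f (\<phi> n) a"] by blast
  have "mono (\<lambda>n. f (\<phi> (\<psi> n)) i)" if "i \<in> A" for i
    using \<phi>(2) that strict_mono_mono[OF \<psi>(1)] by (auto simp: mono_def)
  moreover have "strict_mono (\<lambda>n. \<phi> (\<psi> n))"
    using \<phi>(1) \<psi>(1) by (auto simp: strict_mono_def)
  ultimately show ?case using \<psi>(2) by (intro exI[of _ "\<lambda>n. \<phi> (\<psi> n)"]) auto
qed

text \<open>
  Dickson's lemma, in the form that each exponent vector of a set lies above an element of the set
  with entries bounded by a common constant. A counterexample gives a sequence of vectors; along a
  subsequence that is nondecreasing in all coordinates, the first vector refutes the choice of a
  later one.
\<close>

lemma Dickson:
  fixes E :: "('n::finite \<Rightarrow>\<^sub>0 nat) set"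
  shows "\<exists>N. \<forall>v\<in>E. \<exists>g\<in>E. \<forall>i. Poly_Mapping.lookup g i \<le> Poly_Mapping.lookup v i \<and> Poly_Mapping.lookup g i \<le> N"
proof (rule ccontr)
  assume "\<not> ?thesis"
  then have "\<forall>N. \<exists>v\<in>E. \<forall>g\<in>E. \<exists>i. \<not> (Poly_Mapping.lookup g i \<le> Poly_Mapping.lookup v i \<and> Poly_Mapping.lookup g i \<le> N)"
    by blast
  then obtain f where f: "\<And>N. f N \<in> E"
    "\<And>N g. g \<in> E \<Longrightarrow> \<exists>i. \<not> (Poly_Mapping.lookup g i \<le> Poly_Mapping.lookup (f N) i \<and> Poly_Mapping.lookup g i \<le> N)"
    by metis
  obtain \<phi> :: "nat \<Rightarrow> nat" where \<phi>: "strict_mono \<phi>" "\<And>i. mono (\<lambda>n. Poly_Mapping.lookup (f (\<phi> n)) i)"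
    using coordinatewise_nondecreasing_subsequence[of UNIV "\<lambda>n. Poly_Mapping.lookup (f n)"] by auto
  define M where "M = mon_degree (f (\<phi> 0))"
  have "Poly_Mapping.lookup (f (\<phi> 0)) i \<le> M" for i
    unfolding M_def mon_degree_UNIV by (rule member_le_sum) auto
  moreover have "M \<le> \<phi> M" using \<phi>(1) by (rule strict_mono_imp_increasing)
  ultimately have "Poly_Mapping.lookup (f (\<phi> 0)) i \<le> \<phi> M" for i
    by (meson le_trans)
  moreover have "Poly_Mapping.lookup (f (\<phi> 0)) i \<le> Poly_Mapping.lookup (f (\<phi> M)) i" for i
    using \<phi>(2)[of i] by (auto simp: mono_def)
  ultimately show False using f(2)[OF f(1)[of "\<phi> 0"], of "\<phi> M"] by blast
qed

text \<open>
  The consequence of Borel type that is used: if \<open>u\<close> is outside the ideal but its product with the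
  variable \<open>i\<close> is inside, then some multiple of \<open>u\<close> by a monomial in the variables up to \<open>i\<close> is still
  outside, and is multiplied into the ideal by each of these variables.
\<close>

definition socle_property :: "('n::linorder \<Rightarrow>\<^sub>0 nat) set \<Rightarrow> bool" where
  "socle_property E \<longleftrightarrow> (\<forall>u i. u \<notin> E \<longrightarrow> u + Poly_Mapping.single i 1 \<in> E \<longrightarrow>
     (\<exists>w. Poly_Mapping.keys w \<subseteq> {..i} \<and> u + w \<notin> E \<and> (\<forall>l\<le>i. u + w + Poly_Mapping.single l 1 \<in> E)))"

lemma monomial_in_ideal_power:
  fixes w :: "'n::finite \<Rightarrow>\<^sub>0 nat"
  assumes "Poly_Mapping.keys w \<subseteq> A" "k \<le> mon_degree w"
  shows "(monomial w :: ('n, 'a::comm_ring_1) mpoly) \<in> ideal_power (ideal_gen (Var ` A)) k"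
  using assms
proof (induction k arbitrary: w)
  case 0
  then show ?case by simp
next
  case (Suc k)
  then have "w \<noteq> 0" by auto
  then have "Poly_Mapping.keys w \<noteq> {}" by simp
  then obtain l where l: "l \<in> Poly_Mapping.keys w" by blast
  let ?w = "w - Poly_Mapping.single l 1"
  have eq: "w = Poly_Mapping.single l 1 + ?w"
    by (rule exponent_split) (use l in \<open>simp add: in_keys_iff\<close>)
  have "mon_degree w = 1 + mon_degree ?w"
    using arg_cong[OF eq, of mon_degree] by (simp add: mon_degree_add)
  moreover have "Poly_Mapping.keys ?w \<subseteq> Poly_Mapping.keys w"
    by (auto simp: in_keys_iff lookup_minus)
  ultimately have IH: "(monomial ?w :: ('n, 'a) mpoly) \<in> ideal_power (ideal_gen (Var ` A)) k"
    using Suc.prems by (intro Suc.IH) auto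
  have "(Var l :: ('n, 'a) mpoly) \<in> ideal_gen (Var ` A)"
    unfolding ideal_gen_eq_span using l Suc.prems(1) by (intro imod.span_base) blast
  then have "Var l * (monomial ?w :: ('n, 'a) mpoly) \<in> ideal_power (ideal_gen (Var ` A)) (Suc k)"
    using IH unfolding ideal_power.simps by (rule ideal_prod_times)
  moreover have "(monomial w :: ('n, 'a) mpoly) = Var l * monomial ?w"
    using arg_cong[OF eq, of monomial] by (simp add: monomial_add Var_def)
  ultimately show ?case by simp
qed

text \<open>
  By the Borel type condition the monomials \<open>w\<close> in the variables up to \<open>i\<close> whose product with \<open>u\<close>
  is outside the ideal have bounded degree; one of greatest degree has the required property.
\<close>

lemma Borel_type_imp_socle_property:
  fixes E :: "('n::{finite,linorder} \<Rightarrow>\<^sub>0 nat) set"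
  assumes up: "up_closed E" and borel: "Borel_type (mon_ideal E :: ('n, 'a::comm_ring_1) mpoly set)"
  shows "socle_property E"
  unfolding socle_property_def
proof (intro allI impI)
  fix u i assume u: "u \<notin> E" "u + Poly_Mapping.single i 1 \<in> E"
  let ?I = "mon_ideal E :: ('n, 'a) mpoly set"
  have sub: "imod.subspace ?I" by (rule mon_ideal_subspace[OF up])
  have mem: "monomial t \<in> ?I \<longleftrightarrow> t \<in> E" for t
    using exps_mon_ideal[of E, where ?'a = 'a] by (auto simp: exps_def)
  have sub': "imod.subspace {f. monomial u * f \<in> ?I}"
    using imod.subspace_add[OF sub] imod.subspace_scale[OF sub] imod.subspace_0[OF sub]
    by (intro imod.subspaceI) (auto simp: distrib_left mult.left_commute)
  have "monomial u * Var i \<in> ?I"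
    using u(2) mem by (simp add: Var_def monomial_add[symmetric])
  then have gen: "ideal_gen {Var i} \<subseteq> {f. monomial u * f \<in> ?I}"
    unfolding ideal_gen_eq_span by (intro imod.span_minimal sub') auto
  have "ideal_power (ideal_gen {Var i}) 1 \<subseteq> {f. monomial u * f \<in> ?I}"
    unfolding One_nat_def ideal_power.simps
  proof (rule ideal_prod_subset[OF sub'])
    fix f g :: "('n, 'a) mpoly"
    assume "f \<in> ideal_gen {Var i}"
    then have "f \<in> {f. monomial u * f \<in> ?I}" using gen by blast
    then have "g * f \<in> {f. monomial u * f \<in> ?I}" by (rule imod.subspace_scale[OF sub'])
    then show "f * g \<in> {f. monomial u * f \<in> ?I}" by (simp only: mult.commute)
  qed
  then have "monomial u \<in> ideal_colon ?I (ideal_power (ideal_gen {Var i}) 1)"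
    by (auto simp: ideal_colon_def)
  then have "monomial u \<in> ideal_saturation ?I (ideal_gen {Var i})"
    unfolding ideal_saturation_def by blast
  then have "monomial u \<in> ideal_saturation ?I (ideal_gen (Var ` {..i}))"
    using borel unfolding Borel_type_def by blast
  then obtain k where k: "monomial u \<in> ideal_colon ?I (ideal_power (ideal_gen (Var ` {..i})) k)"
    unfolding ideal_saturation_def by blast
  define P where "P w \<longleftrightarrow> Poly_Mapping.keys w \<subseteq> {..i} \<and> u + w \<notin> E" for w
  have bound: "mon_degree w < k" if "P w" for w
  proof (rule ccontr)
    assume "\<not> mon_degree w < k"
    then have "(monomial w :: ('n, 'a) mpoly) \<in> ideal_power (ideal_gen (Var ` {..i})) k"
      using that by (intro monomial_in_ideal_power) (auto simp: P_def)
    then have "monomial u * monomial w \<in> ?I" using k by (auto simp: ideal_colon_def)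
    then show False using that mem by (simp add: monomial_add[symmetric] P_def)
  qed
  have "P 0" using u(1) by (simp add: P_def)
  then obtain w where w: "P w" and greatest: "\<And>w'. P w' \<Longrightarrow> mon_degree w' \<le> mon_degree w"
    using ex_has_greatest_nat[of P 0 mon_degree k] bound by (meson less_imp_le)
  have "u + w + Poly_Mapping.single l 1 \<in> E" if "l \<le> i" for l
  proof (rule ccontr)
    assume "u + w + Poly_Mapping.single l 1 \<notin> E"
    moreover have "Poly_Mapping.keys (w + Poly_Mapping.single l 1) \<subseteq> {..i}"
      using keys_add[of w "Poly_Mapping.single l 1"] w that by (auto simp: P_def)
    ultimately have "P (w + Poly_Mapping.single l 1)" by (simp add: P_def add.assoc)
    then show False using greatest[of "w + Poly_Mapping.single l 1"] by (simp add: mon_degree_add)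
  qed
  then show "\<exists>w. Poly_Mapping.keys w \<subseteq> {..i} \<and> u + w \<notin> E \<and> (\<forall>l\<le>i. u + w + Poly_Mapping.single l 1 \<in> E)"
    using w unfolding P_def by blast
qed

lemma socle_property_last:
  fixes E :: "('n::{finite,linorder} \<Rightarrow>\<^sub>0 nat) set"
  assumes soc: "socle_property E" and v: "v \<in> E" "v \<noteq> 0"
    and not: "v - Poly_Mapping.single (Max (Poly_Mapping.keys v)) 1 \<notin> E"
  shows "\<exists>z i. z \<notin> E \<and> (\<forall>l\<le>i. z + Poly_Mapping.single l 1 \<in> E) \<and>
    (\<forall>l>i. Poly_Mapping.lookup z l = 0) \<and> mon_degree v \<le> mon_degree z + 1"
proof -
  let ?i = "Max (Poly_Mapping.keys v)"
  define u where "u = v - Poly_Mapping.single ?i 1"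
  have vu: "v = u + Poly_Mapping.single ?i 1"
    using exponent_split[OF Max_keys_pos[OF v(2)]] by (simp add: u_def add.commute)
  obtain w where w: "Poly_Mapping.keys w \<subseteq> {..?i}" "u + w \<notin> E"
    "\<forall>l\<le>?i. u + w + Poly_Mapping.single l 1 \<in> E"
    using soc[unfolded socle_property_def, rule_format, of u ?i] not v(1) vu unfolding u_def by metis
  have "Poly_Mapping.lookup (u + w) l = 0" if "l > ?i" for l
  proof -
    have "l \<notin> Poly_Mapping.keys v" using that by (meson Max_ge finite_keys leD)
    then have "Poly_Mapping.lookup u l = 0" by (simp add: u_def lookup_minus in_keys_iff)
    moreover have "l \<notin> Poly_Mapping.keys w" using w(1) that by auto
    ultimately show ?thesis by (simp add: lookup_add in_keys_iff)
  qed
  moreover have "mon_degree v \<le> mon_degree (u + w) + 1"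
    using arg_cong[OF vu, of mon_degree] by (simp add: mon_degree_add)
  ultimately show ?thesis using w by blast
qed

text \<open>
  If a monomial \<open>z\<close> is outside the ideal and its product with the variable \<open>l\<close> is inside, then some
  monomial of the ideal with all exponents at most \<open>N\<close> divides this product but not \<open>z\<close>, so the
  exponent of \<open>l\<close> in \<open>z\<close> is at most \<open>N\<close>. Hence the monomials at which reducibility fails have
  bounded degree.
\<close>

lemma socle_property_imp_last_reducible:
  fixes E :: "('n::{finite,linorder} \<Rightarrow>\<^sub>0 nat) set"
  assumes up: "up_closed E" and soc: "socle_property E"
  shows "\<exists>N. last_reducible (real N) E"
proof -
  obtain N where N: "\<And>v. v \<in> E \<Longrightarrow> \<exists>g\<in>E. \<forall>i. Poly_Mapping.lookup g i \<le> Poly_Mapping.lookup v i \<and> Poly_Mapping.lookup g i \<le> N"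
    using Dickson[of E] by blast
  have "last_reducible (real (card (UNIV :: 'n set) * N + 1)) E"
    unfolding last_reducible_def
  proof (intro ballI impI, rule ccontr)
    fix v assume v: "v \<in> E" "v \<noteq> 0 \<and> real (mon_degree v) > real (card (UNIV :: 'n set) * N + 1)"
      and not: "v - Poly_Mapping.single (Max (Poly_Mapping.keys v)) 1 \<notin> E"
    obtain z i where z: "z \<notin> E" "\<And>l. l \<le> i \<Longrightarrow> z + Poly_Mapping.single l 1 \<in> E"
      "\<And>l. l > i \<Longrightarrow> Poly_Mapping.lookup z l = 0" "mon_degree v \<le> mon_degree z + 1"
      using socle_property_last[OF soc v(1) _ not] v(2) by blast
    have "Poly_Mapping.lookup z l \<le> N" for l
    proof (rule ccontr)
      assume zl: "\<not> Poly_Mapping.lookup z l \<le> N"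
      then have "l \<le> i" using z(3)[of l] by (metis le0 not_le)
      then obtain g where g: "g \<in> E" "\<And>k. Poly_Mapping.lookup g k \<le> Poly_Mapping.lookup (z + Poly_Mapping.single l 1) k"
        "\<And>k. Poly_Mapping.lookup g k \<le> N"
        using N[OF z(2)] by blast
      have "Poly_Mapping.lookup g k \<le> Poly_Mapping.lookup z k" for k
        using g(2)[of k] g(3)[of k] zl by (cases "k = l") (auto simp: lookup_add lookup_single)
      then have "z = g + (z - g)"
        by (intro poly_mapping_eqI) (simp add: lookup_add lookup_minus)
      then show False using z(1) up_closedD[OF up g(1)] by metis
    qed
    then have "mon_degree z \<le> (\<Sum>l\<in>(UNIV :: 'n set). N)"
      unfolding mon_degree_UNIV by (rule sum_mono)
    then show False using v(2) z(4) by simp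
  qed
  then show ?thesis by blast
qed

section \<open>Regularity\<close>

text \<open>The bound \<open>\<rho>\<close> is only used for the existence of minimal resolutions.\<close>

lemma reg_mon_ideal:
  fixes E :: "('n::{finite,linorder} \<Rightarrow>\<^sub>0 nat) set"
  assumes up: "up_closed E" and red: "last_reducible \<rho> E" "\<rho> \<ge> 0"
  shows "reg_ideal (mon_ideal E :: ('n, 'a::field) mpoly set) =
    Sup {ereal (of_int (j - int i)) | i j. \<not> kvanish 1 (\<lambda>_. 0) (emb (mon_ideal E :: ('n, 'a) mpoly set)) i j}"
proof -
  have van: "\<exists>B. \<forall>j>B. kvanish 1 (\<lambda>_. 0) (emb (mon_ideal E :: ('n, 'a) mpoly set)) q j" for q
  proof (intro exI allI impI)
    fix j assume "j > \<lceil>\<rho>\<rceil> + int q"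
    then have "real_of_int (j - int q) > \<rho>" by linarith
    then show "kvanish 1 (\<lambda>_. 0) (emb (mon_ideal E :: ('n, 'a) mpoly set)) q j"
      by (rule kvanish_mon_ideal[OF red])
  qed
  show ?thesis
    unfolding reg_ideal_def reg_def betti_nonzero_iff[OF graded_sub_emb[OF up] van] ..
qed

lemma reg_mon_ideal_le:
  fixes E :: "('n::{finite,linorder} \<Rightarrow>\<^sub>0 nat) set"
  assumes up: "up_closed E" and red: "last_reducible \<rho> E" "\<rho> \<ge> 0"
  shows "reg_ideal (mon_ideal E :: ('n, 'a::field) mpoly set) \<le> ereal \<rho>"
  unfolding reg_mon_ideal[OF assms]
proof (rule Sup_least)
  fix x
  assume "x \<in> {ereal (of_int (j - int i)) | i j.
    \<not> kvanish 1 (\<lambda>_. 0) (emb (mon_ideal E :: ('n, 'a) mpoly set)) i j}"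
  then obtain i j where x: "x = ereal (of_int (j - int i))"
    and nv: "\<not> kvanish 1 (\<lambda>_. 0) (emb (mon_ideal E :: ('n, 'a) mpoly set)) i j" by blast
  have "\<not> real_of_int (j - int i) > \<rho>" using kvanish_mon_ideal[OF red] nv by blast
  then show "x \<le> ereal \<rho>" unfolding x by simp
qed

text \<open>
  Conversely, a nonzero ideal of Borel type is last reducible for its regularity.
\<close>

lemma reg_Borel_type:
  fixes I :: "('n::{finite,linorder}, 'a::field) mpoly set"
  assumes "monomial_ideal I" "Borel_type I" "exps I \<noteq> {}"
  shows "\<exists>e\<ge>0. reg_ideal I = ereal e \<and> last_reducible e (exps I)"
proof -
  define E where "E = exps I"
  have up: "up_closed E" and I: "I = mon_ideal E"
    using monomial_ideal_up_closed[OF assms(1)] monomial_ideal_eq_mon_ideal[OF assms(1)]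
    by (simp_all add: E_def)
  have soc: "socle_property E"
    using Borel_type_imp_socle_property[OF up] assms(2) unfolding I by blast
  obtain N where N: "last_reducible (real N) E"
    using socle_property_imp_last_reducible[OF up soc] by blast
  note reg = reg_mon_ideal[OF up N of_nat_0_le_iff, where ?'a = 'a]
  have upper: "reg_ideal I \<le> ereal (real N)"
    unfolding I by (rule reg_mon_ideal_le[OF up N]) simp
  have ge: "ereal (of_int (j - int i)) \<le> reg_ideal I"
    if "\<not> kvanish 1 (\<lambda>_. 0) (emb (mon_ideal E :: ('n, 'a) mpoly set)) i j" for i j
    unfolding I reg using that by (intro Sup_upper) blast
  obtain m where "\<not> kvanish 1 (\<lambda>_. 0) (emb (mon_ideal E :: ('n, 'a) mpoly set)) 0 (int m)"
    using not_kvanish_0_mon_ideal assms(3) unfolding E_def by blast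
  from ge[OF this] have "ereal (real m) \<le> reg_ideal I" by simp
  with upper obtain e where e: "reg_ideal I = ereal e" and "real m \<le> e"
    by (cases "reg_ideal I") auto
  have "last_reducible e E"
    unfolding last_reducible_def
  proof (intro ballI impI, rule ccontr)
    fix v assume v: "v \<in> E" "v \<noteq> 0 \<and> real (mon_degree v) > e"
      and not: "v - Poly_Mapping.single (Max (Poly_Mapping.keys v)) 1 \<notin> E"
    obtain z i where z: "z \<notin> E" "\<And>l. l \<le> i \<Longrightarrow> z + Poly_Mapping.single l 1 \<in> E"
      "\<And>l. l > i \<Longrightarrow> Poly_Mapping.lookup z l = 0" "mon_degree v \<le> mon_degree z + 1"
      using socle_property_last[OF soc v(1) _ not] v(2) by blast
    have "{..i} \<noteq> {}" by auto
    then have "0 < card {..i}" by (simp add: card_gt_0_iff)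
    then have "int (mon_degree z + card {..i}) - int (card {..i} - 1) = int (mon_degree z) + 1"
      by simp
    then have "ereal (real (mon_degree z) + 1) \<le> ereal e"
      using ge[OF not_kvanish_mon_ideal[of z E i, OF z(1-3)]] unfolding e by simp
    then show False using v(2) z(4) by simp
  qed
  then show ?thesis using e \<open>real m \<le> e\<close> by (auto simp: E_def intro!: exI[of _ e])
qed

lemma reg_zero_ideal: "reg_ideal (mon_ideal {} :: ('n::{finite,linorder}, 'a::field) mpoly set) = -\<infinity>"
proof -
  have "kvanish 1 (\<lambda>_. 0) (emb (mon_ideal {} :: ('n, 'a) mpoly set)) i j" for i j
    unfolding kvanish_def
  proof (intro ballI impI)
    fix c :: "'n set \<Rightarrow> nat \<Rightarrow> ('n, 'a) mpoly"
    assume c: "c \<in> kchains 1 (\<lambda>_. 0) (emb (mon_ideal {})) i j"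
    have up: "up_closed ({} :: ('n \<Rightarrow>\<^sub>0 nat) set)" by (simp add: up_closed_def)
    then have sub: "vmod.subspace (emb (mon_ideal {} :: ('n, 'a) mpoly set))"
      using graded_sub_emb unfolding graded_sub_def by blast
    have "c T k = 0" for T k
      using kchains_in[OF sub c, of T] by (cases "k = 0") (auto simp: emb_def mon_ideal_def)
    then have "kosz 0 = c" by (auto simp: fun_eq_iff kosz_def)
    moreover have "0 \<in> kchains 1 (\<lambda>_. 0) (emb (mon_ideal {} :: ('n, 'a) mpoly set)) (Suc i) j"
      using vmod.subspace_0[OF sub] by (simp add: kchains_def)
    ultimately show "\<exists>b\<in>kchains 1 (\<lambda>_. 0) (emb (mon_ideal {})) (Suc i) j. kosz b = c" by blast
  qed
  moreover have "up_closed ({} :: ('n \<Rightarrow>\<^sub>0 nat) set)" "last_reducible 0 ({} :: ('n \<Rightarrow>\<^sub>0 nat) set)"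
    by (auto simp: up_closed_def last_reducible_def)
  ultimately show ?thesis
    by (simp add: reg_mon_ideal bot_ereal_def)
qed

theorem theorem1p2p15:
  fixes I J :: "('n::{finite, linorder}, 'a::field) mpoly set"
  assumes "infinite (UNIV :: 'a set)"
    and "CARD('n) \<ge> 2"
    and "monomial_ideal I" and "Borel_type I"
    and "monomial_ideal J" and "Borel_type J"
  shows "reg_ideal (ideal_prod I J) \<le> reg_ideal I + reg_ideal J"
proof -
  have upI: "up_closed (exps I)" and upJ: "up_closed (exps J)"
    by (rule monomial_ideal_up_closed[OF assms(3)]) (rule monomial_ideal_up_closed[OF assms(5)])
  have prod: "ideal_prod I J = mon_ideal (sum_set (exps I) (exps J))"
    using ideal_prod_mon_ideal[OF upI, of "exps J"]
      monomial_ideal_eq_mon_ideal[OF assms(3)] monomial_ideal_eq_mon_ideal[OF assms(5)] by metis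
  show ?thesis
  proof (cases "exps I = {} \<or> exps J = {}")
    case True
    then have "sum_set (exps I) (exps J) = {}" by (auto simp: sum_set_def)
    then show ?thesis unfolding prod by (simp add: reg_zero_ideal)
  next
    case False
    obtain e where e: "e \<ge> 0" "reg_ideal I = ereal e" "last_reducible e (exps I)"
      using reg_Borel_type[OF assms(3,4)] False by blast
    obtain f where f: "f \<ge> 0" "reg_ideal J = ereal f" "last_reducible f (exps J)"
      using reg_Borel_type[OF assms(5,6)] False by blast
    have "last_reducible (e + f) (sum_set (exps I) (exps J))"
      by (rule last_reducible_sum_set[OF e(3) upI e(1) f(3) upJ f(1)])
    then have "reg_ideal (ideal_prod I J) \<le> ereal (e + f)"
      unfolding prod using e(1) f(1) by (intro reg_mon_ideal_le up_closed_sum_set upI) auto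
    then show ?thesis by (simp add: e(2) f(2))
  qed
qed

end
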